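(* Let $G$ be a finite group. If $G$ has the minimal generating set exchange (MGSE) property, then $G$ is solvable.
   Context: For a finite group $G$, $d(G)$ denotes the smallest cardinality of a generating set of $G$. A finite group $G$ has the minimal generating set exchange (MGSE) property if, with $d=d(G)$, whenever $x_1,\dots,x_d,y_1,\dots,y_d\in G$ satisfy $\langle x_1,\dots,x_d\rangle=\langle y_1,\dots,y_d\rangle=G$, then for every $1\le i\le d$ there exists $1\le j\le d$ such that $\langle x_1,\dots,x_{i-1},y_j,x_{i+1},\dots,x_d\rangle=G$. *)

theory Defs
  imports "HOL-Algebra.Solvable_Groups"
begin

text \<open>Finiteness of \<open>S\<close> is required because \<^const>\<open>card\<close> is 0 on infinite sets; it is automatic
  when \<open>G\<close> is finite, the only case in which the two notions below are used.\<close>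

definition min_gen_number :: "('a, 'b) monoid_scheme \<Rightarrow> nat" where
  "min_gen_number G =
     (LEAST n. \<exists>S. S \<subseteq> carrier G \<and> finite S \<and> card S = n \<and> generate G S = carrier G)"

text \<open>A \<open>d\<close>-tuple \<open>x\<^sub>1, \<dots>, x\<^sub>d\<close> is a function on \<^typ>\<open>nat\<close> of which only the values on
  \<open>{1..d}\<close> matter; repeated entries are allowed.\<close>

definition MGSE :: "('a, 'b) monoid_scheme \<Rightarrow> bool" where
  "MGSE G \<longleftrightarrow>
     (let d = min_gen_number G in
      \<forall>x y :: nat \<Rightarrow> 'a.
        x \<in> {1..d} \<rightarrow> carrier G \<longrightarrow> y \<in> {1..d} \<rightarrow> carrier G \<longrightarrow>
        generate G (x ` {1..d}) = carrier G \<longrightarrow> generate G (y ` {1..d}) = carrier G \<longrightarrow>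
        (\<forall>i\<in>{1..d}. \<exists>j\<in>{1..d}. generate G ((x(i := y j)) ` {1..d}) = carrier G))"

end

theory Submission
  imports Defs "HOL-Algebra.Sylow" "HOL-Algebra.Group_Action"
begin

text \<open>By the exchange property the generating sets of size \<open>d = d(G)\<close> are the bases of a matroid on a
  subset of \<open>G\<close>, and multiplying a basis element by another one yields a basis again. It follows
  that every hyperplane generates a proper subgroup, that the elements lying in no basis form a
  normal subgroup \<open>N\<close> of non-generators, and, by the argument for the Frattini subgroup, that \<open>N\<close>
  is solvable. Since \<open>G/N\<close> inherits the exchange property, one may assume \<open>N = 1\<close> and \<open>d \<ge> 2\<close>. The
  classes of parallel elements then form a partition of \<open>G\<close> into subgroups (points), each of
  them either normal or self-normalizing. Counting shows that the nonnormal points form at most one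
  conjugacy class; if there is one, then together with the normal points any nontrivial element of a
  nonnormal point generates \<open>G\<close>. If there are at least two normal points, they commute, so that
  they generate an abelian normal subgroup with cyclic quotient; if there is only one, the Frattini
  argument provides such a subgroup.\<close>

section \<open>Group actions and a Frattini argument\<close>

text \<open>Hyperplanes generate proper subgroups because of one invariance: left multiplication by
  an element of the flat maps elements completing \<open>I\<close> to a basis to such elements
  again, so a completing element of the generated subgroup would make \<one> completing as well. The
  obstacle in the loopless case is that the elements of normal points are not known to form a
  subgroup. A nonnormal point P resembles a Frobenius complement: it is self-normalizing and its
  distinct conjugates meet trivially, so their nontrivial elements make up the fraction 1 - 1/|P| of
  the group, which is at least one half. What remains has |G|/|P| elements, the size of a Frobenius
  kernel. Only this cardinality is used: distinct elements of normal points lie in distinct left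
  cosets of P, hence every g is a product of an element n of a normal point and an element p of P.
  Every conjugate of P is therefore a conjugate by such an n, and this is what lets the normal
  points together with a single element of P generate.\<close>

abbreviation conjg :: "('a, 'b) monoid_scheme \<Rightarrow> 'a \<Rightarrow> 'a \<Rightarrow> 'a" where
  "conjg G g x \<equiv> g \<otimes>\<^bsub>G\<^esub> x \<otimes>\<^bsub>G\<^esub> inv\<^bsub>G\<^esub> g"

context group
begin

lemma finite_submonoid_is_subgroup:
  assumes H: "H \<subseteq> carrier G" "finite H" "\<one> \<in> H"
    and cl: "\<And>x y. x \<in> H \<Longrightarrow> y \<in> H \<Longrightarrow> x \<otimes> y \<in> H"
  shows "subgroup H G"
proof (rule subgroupI)
  fix x assume x: "x \<in> H"
  have xc: "x \<in> carrier G" using x H by auto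
  have "inj_on (\<lambda>h. h \<otimes> x) H"
    using H(1) xc by (auto simp: inj_on_def subset_iff)
  moreover have "(\<lambda>h. h \<otimes> x) ` H \<subseteq> H" using cl x by auto
  ultimately have "(\<lambda>h. h \<otimes> x) ` H = H"
    using H(2) by (metis endo_inj_surj)
  then obtain h where h: "h \<in> H" "h \<otimes> x = \<one>" using H(3) by (metis imageE)
  then have "inv x = h" using inv_equality[of h x] xc H(1) by auto
  with h show "inv x \<in> H" by simp
qed (use H cl in auto)

lemma inv_mult_cancel [simp]:
  "x \<in> carrier G \<Longrightarrow> y \<in> carrier G \<Longrightarrow> inv x \<otimes> (x \<otimes> y) = y"
  "x \<in> carrier G \<Longrightarrow> y \<in> carrier G \<Longrightarrow> x \<otimes> (inv x \<otimes> y) = y"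
  by (simp_all add: m_assoc[symmetric])

lemma conjg_mult:
  "\<lbrakk>g \<in> carrier G; x \<in> carrier G; y \<in> carrier G\<rbrakk>
    \<Longrightarrow> conjg G g (x \<otimes> y) = conjg G g x \<otimes> conjg G g y"
  by (simp add: m_assoc)

lemma conjg_conjg:
  "\<lbrakk>g \<in> carrier G; h \<in> carrier G; x \<in> carrier G\<rbrakk>
    \<Longrightarrow> conjg G (g \<otimes> h) x = conjg G g (conjg G h x)"
  by (simp add: m_assoc inv_mult_group)

lemma conjg_inv_cancel:
  "\<lbrakk>g \<in> carrier G; x \<in> carrier G\<rbrakk> \<Longrightarrow> conjg G (inv g) (conjg G g x) = x"
  "\<lbrakk>g \<in> carrier G; x \<in> carrier G\<rbrakk> \<Longrightarrow> conjg G g (conjg G (inv g) x) = x"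
  by (simp_all add: m_assoc)

lemma conjg_inv:
  "\<lbrakk>g \<in> carrier G; x \<in> carrier G\<rbrakk> \<Longrightarrow> conjg G g (inv x) = inv (conjg G g x)"
  by (simp add: m_assoc inv_mult_group)

lemma conjg_inj: "\<lbrakk>g \<in> carrier G; x \<in> carrier G; y \<in> carrier G\<rbrakk>
   \<Longrightarrow> conjg G g x = conjg G g y \<longleftrightarrow> x = y"
  by simp

lemma conjg_eq_one_iff: "\<lbrakk>g \<in> carrier G; x \<in> carrier G\<rbrakk> \<Longrightarrow> conjg G g x = \<one> \<longleftrightarrow> x = \<one>"
  using conjg_inj[of g x \<one>] by simp

lemma group_hom_conjg:
  assumes "g \<in> carrier G"
  shows "group_hom G G (conjg G g)"
  unfolding group_hom_def group_hom_axioms_def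
  using assms by (auto intro!: homI simp: conjg_mult group_axioms simp del: m_assoc)

lemma generate_closed:
  assumes "S \<subseteq> carrier G" "x \<in> generate G S" "y \<in> generate G S"
  shows "x \<otimes> y \<in> generate G S" "inv x \<in> generate G S" "conjg G x y \<in> generate G S"
  using assms by (auto intro: generate.eng generate_m_inv_closed)

lemma subgroup_conjg_closed:
  assumes "subgroup H G" "g \<in> H" "x \<in> H"
  shows "conjg G g x \<in> H"
  using assms by (simp add: subgroup.m_closed subgroup.m_inv_closed)

end

text \<open>The orbit of a point that is not fixed has a size dividing \<open>p ^ a\<close> and
  different from 1, and these orbits partition the complement of the fixed points.\<close>

lemma (in group_action) p_group_fixed_points:
  assumes fE: "finite E" and p: "prime p" and ord: "order G = p ^ a"
  shows "p dvd card (E - {x \<in> E. \<forall>g\<in>carrier G. \<phi> g x = x})"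
proof -
  let ?F = "{x \<in> E. \<forall>g\<in>carrier G. \<phi> g x = x}"
  let ?C = "orbit G \<phi> ` (E - ?F)"
  have orb_sub: "orbit G \<phi> x \<subseteq> E" if "x \<in> E" for x
    using that element_image by (auto simp: orbit_def)
  have self: "x \<in> orbit G \<phi> x" if "x \<in> E" for x
    using that orbit_refl by blast
  have orb_eq: "orbit G \<phi> x = orbit G \<phi> y" if "x \<in> E" "y \<in> E" "z \<in> orbit G \<phi> x" "z \<in> orbit G \<phi> y" for x y z
    using disjoint_union[of "orbit G \<phi> x" "orbit G \<phi> y"] that by (auto simp: orbits_def)
  have fixed_orbit: "orbit G \<phi> x = {x}" if "x \<in> ?F" for x
    using that self[of x] by (auto simp: orbit_def)
  have un: "\<Union>?C = E - ?F"
  proof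
    show "\<Union>?C \<subseteq> E - ?F"
    proof
      fix y assume "y \<in> \<Union>?C"
      then obtain x where x: "x \<in> E" "x \<notin> ?F" "y \<in> orbit G \<phi> x" by blast
      have yE: "y \<in> E" using x orb_sub by blast
      have "y \<notin> ?F"
      proof
        assume "y \<in> ?F"
        then have "orbit G \<phi> x = {y}" using fixed_orbit orb_eq[OF x(1) yE x(3) self[OF yE]] by simp
        then have "x = y" using self[OF x(1)] by auto
        then show False using x \<open>y \<in> ?F\<close> by simp
      qed
      then show "y \<in> E - ?F" using yE by blast
    qed
  qed (use self in blast)
  have "p dvd card (\<Union>?C)"
  proof (rule dvd_partition)
    show "finite (\<Union>?C)" using un fE by auto
    show "\<forall>c\<in>?C. p dvd card c"
    proof
      fix c assume "c \<in> ?C"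
      then obtain x where x: "x \<in> E" "x \<notin> ?F" and c: "c = orbit G \<phi> x" by blast
      have "card c dvd p ^ a"
        using orbit_stabilizer_theorem[OF x(1)] ord c by (metis dvd_triv_left)
      moreover have "card c \<noteq> 1"
      proof
        assume "card c = 1"
        then have "c = {x}" using self[OF x(1)] c by (auto simp: card_1_singleton_iff)
        then have "\<phi> g x = x" if "g \<in> carrier G" for g using that c by (auto simp: orbit_def)
        then show False using x by blast
      qed
      ultimately show "p dvd card c"
        using p by (metis divides_primepow_nat dvd_power not_gr_zero power_0)
    qed
    show "\<forall>c1\<in>?C. \<forall>c2\<in>?C. c1 \<noteq> c2 \<longrightarrow> c1 \<inter> c2 = {}"
      using orb_eq by (blast)
  qed
  then show ?thesis using un by simp
qed

text \<open>The action is given by a bare function with laws only on \<open>Q\<close> and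
  \<open>E\<close>, so that conjugation and coset translation can be plugged in directly. The
  restriction to \<open>E\<close> makes the maps extensional, as elements of
  \<open>BijGroup E\<close> must be.\<close>

lemma (in group) p_subgroup_fixed_points:
  assumes Q: "subgroup Q G" "card Q = p ^ a" and p: "prime p" and E: "finite E"
    and cl: "\<And>g x. g \<in> Q \<Longrightarrow> x \<in> E \<Longrightarrow> f g x \<in> E"
    and one: "\<And>x. x \<in> E \<Longrightarrow> f \<one> x = x"
    and mult: "\<And>g h x. \<lbrakk>g \<in> Q; h \<in> Q; x \<in> E\<rbrakk> \<Longrightarrow> f (g \<otimes> h) x = f g (f h x)"
  shows "p dvd card (E - {x \<in> E. \<forall>g\<in>Q. f g x = x})"
proof -
  let ?Q = "G\<lparr>carrier := Q\<rparr>"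
  let ?f = "\<lambda>g. restrict (f g) E"
  interpret Q: group ?Q using subgroup_imp_group[OF Q(1)] .
  have bij: "bij_betw (f g) E E" if g: "g \<in> Q" for g
  proof (rule bij_betw_byWitness[where f' = "f (inv g)"])
    have ig: "inv g \<in> Q" and gc: "g \<in> carrier G"
      using Q(1) g subgroup.m_inv_closed subgroup.mem_carrier by metis+
    show "\<forall>x\<in>E. f (inv g) (f g x) = x" "\<forall>x\<in>E. f g (f (inv g) x) = x"
      using mult[OF ig g] mult[OF g ig] one gc by simp_all
    show "f g ` E \<subseteq> E" "f (inv g) ` E \<subseteq> E" using cl g ig by auto
  qed
  have "group_action ?Q E ?f"
    unfolding group_action_def
  proof (rule group_hom.intro[OF Q.is_group group_BijGroup group_hom_axioms.intro])
    show "?f \<in> hom ?Q (BijGroup E)"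
    proof (rule homI)
      fix x assume "x \<in> carrier ?Q"
      then show "?f x \<in> carrier (BijGroup E)"
        using bij by (auto simp: BijGroup_def Bij_def)
      fix y assume "y \<in> carrier ?Q"
      with \<open>x \<in> carrier ?Q\<close> show "?f (x \<otimes>\<^bsub>?Q\<^esub> y) = ?f x \<otimes>\<^bsub>BijGroup E\<^esub> ?f y"
        using mult cl bij by (auto simp: BijGroup_def Bij_def compose_def fun_eq_iff)
    qed
  qed
  from group_action.p_group_fixed_points[OF this E p, of a] Q(2)
  have "p dvd card (E - {x \<in> E. \<forall>g\<in>Q. ?f g x = x})" by (simp add: order_def)
  moreover have "{x \<in> E. \<forall>g\<in>Q. ?f g x = x} = {x \<in> E. \<forall>g\<in>Q. f g x = x}" by auto
  ultimately show ?thesis by simp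
qed


context group
begin

text \<open>\<open>Z\<close> is the centre of a Sylow subgroup of \<open>A\<close>.\<close>

lemma frattini_abelian:
  assumes fin: "finite (carrier G)" and A: "A \<lhd> G" and nt: "A \<noteq> {\<one>}"
  obtains Z where "subgroup Z G" "Z \<subseteq> A" "Z \<noteq> {\<one>}"
    "\<And>x y. x \<in> Z \<Longrightarrow> y \<in> Z \<Longrightarrow> x \<otimes> y = y \<otimes> x"
    "\<And>g. g \<in> carrier G \<Longrightarrow> \<exists>a\<in>A. \<forall>z\<in>Z. conjg G (a \<otimes> g) z \<in> Z"
proof -
  interpret A: normal A G by fact
  let ?A = "G\<lparr>carrier := A\<rparr>"
  interpret AG: group ?A using subgroup_imp_group[OF A.subgroup_axioms] .
  have Ac: "A \<subseteq> carrier G" using A.subset .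
  have finA: "finite A" using Ac fin finite_subset by blast
  have "card A \<noteq> 1" using nt A.one_closed by (metis card_1_singletonE singletonD)
  then obtain p where p: "prime p" "p dvd card A" using prime_factor_nat by blast
  have "card A \<noteq> 0" using finA A.one_closed by (metis card_eq_0_iff empty_iff)
  then obtain m where m: "card A = p ^ multiplicity p (card A) * m" "\<not> p dvd m"
    using multiplicity_decompose'[of "card A" p] p by (metis not_prime_unit)
  define a where "a = multiplicity p (card A)"
  have a0: "a > 0" using p \<open>card A \<noteq> 0\<close> by (simp add: a_def prime_multiplicity_gt_zero_iff)
  obtain Q where Q: "subgroup Q ?A" and cQ: "card Q = p ^ a"
    using sylow_thm[OF p(1) AG.is_group, of a m] m(1) finA by (auto simp: order_def a_def)
  have QA: "Q \<subseteq> A" using subgroup.subset[OF Q] by simp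
  have QG: "subgroup Q G" using incl_subgroup[OF A.subgroup_axioms Q] .
  have Qc: "Q \<subseteq> carrier G" using QA Ac by simp
  have finQ: "finite Q" using QA finA finite_subset by blast
  define Z where "Z = {z \<in> Q. \<forall>q\<in>Q. conjg G q z = z}"
  have comm_iff: "conjg G q z = z \<longleftrightarrow> q \<otimes> z = z \<otimes> q" if "q \<in> carrier G" "z \<in> carrier G" for q z
    using that by (metis inv_closed inv_solve_right m_closed)
  have Zsub: "subgroup Z G"
  proof (rule finite_submonoid_is_subgroup)
    show "Z \<subseteq> carrier G" "finite Z" using Qc finQ by (auto simp: Z_def)
    show "\<one> \<in> Z" using subgroup.one_closed[OF QG] Qc by (auto simp: Z_def subset_iff)
    show "x \<otimes> y \<in> Z" if "x \<in> Z" "y \<in> Z" for x y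
      using that Qc subgroup.m_closed[OF QG, of x y]
      by (auto simp: Z_def subset_iff conjg_mult)
  qed
  have Znt: "Z \<noteq> {\<one>}"
  proof
    assume Z1: "Z = {\<one>}"
    \<comment> \<open>The centre of a nontrivial p-group is nontrivial: \<open>Q\<close> acts on
      itself by conjugation, and \<open>Z\<close> is the set of fixed points.\<close>
    have "p dvd card (Q - {x \<in> Q. \<forall>g\<in>Q. conjg G g x = x})"
      by (rule p_subgroup_fixed_points[OF QG cQ p(1) finQ])
        (use Qc in \<open>auto simp: subset_iff conjg_conjg subgroup_conjg_closed[OF QG]\<close>)
    then have "p dvd card Q - 1"
      using Z1 Zsub subgroup.one_closed[OF QG] finQ by (simp add: Z_def card_Diff_singleton)
    moreover have "p dvd card Q" using cQ a0 by (simp add: dvd_power)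
    moreover have "card Q > 0" using cQ p(1) by (simp add: prime_gt_0_nat)
    ultimately have "p dvd 1"
      by (metis One_nat_def Suc_leI dvd_diffD1)
    then show False using p(1) by simp
  qed
  have conj: "\<exists>b\<in>A. \<forall>z\<in>Z. conjg G (b \<otimes> g) z \<in> Z" if g: "g \<in> carrier G" for g
  proof -
    interpret cg: group_hom G G "conjg G g" using group_hom_conjg[OF g] .
    define Q' where "Q' = conjg G g ` Q"
    have Q'G: "subgroup Q' G" unfolding Q'_def using cg.subgroup_img_is_subgroup[OF QG] .
    have Q'A: "Q' \<subseteq> A" unfolding Q'_def using QA A.inv_op_closed2[OF g] by auto
    have "inj_on (conjg G g) Q" using Qc g by (auto simp: inj_on_def subset_iff)
    then have cQ': "card Q' = p ^ a" unfolding Q'_def using cQ card_image by metis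
    define E where "E = rcosets\<^bsub>?A\<^esub> Q"
    have E_alt: "E = (\<lambda>b. Q #> b) ` A" unfolding E_def RCOSETS_def by auto
    have finE: "finite E" using E_alt finA by simp
    have "card E * p ^ a = p ^ a * m"
      using AG.lagrange[OF Q] m(1) cQ by (simp add: E_def order_def a_def)
    then have cE: "card E = m" using p(1) by (simp add: prime_gt_0_nat)
    \<comment> \<open>The conjugate \<open>Q'\<close> acts on the right cosets of \<open>Q\<close>
      in \<open>A\<close>; the inverse turns right translation into a left action. The number
      \<open>m\<close> of cosets is prime to \<open>p\<close>, so some coset \<open>Q #> b\<close>
      is fixed, and this forces conjugation by \<open>b\<close> to carry \<open>Q'\<close> into
      \<open>Q\<close>.\<close>
    have "p dvd card (E - {C \<in> E. \<forall>q\<in>Q'. C #> inv q = C})"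
    proof (rule p_subgroup_fixed_points[OF Q'G cQ' p(1) finE])
      fix q C assume q: "q \<in> Q'" and "C \<in> E"
      then obtain b where b: "b \<in> A" "C = Q #> b" unfolding E_alt by blast
      have qc: "q \<in> A" using q Q'A by blast
      then have "C #> inv q = Q #> (b \<otimes> inv q)" using b Qc Ac by (simp add: coset_mult_assoc subset_iff)
      moreover have "b \<otimes> inv q \<in> A" using b qc by simp
      ultimately show "C #> inv q \<in> E" unfolding E_alt by blast
    next
      fix C assume "C \<in> E"
      then have "C \<subseteq> carrier G" unfolding E_alt using Qc Ac r_coset_subset_G by blast
      then show "C #> inv \<one> = C" by simp
    next
      fix q r C assume q: "q \<in> Q'" "r \<in> Q'" and "C \<in> E"
      then have "C \<subseteq> carrier G" unfolding E_alt using Qc Ac r_coset_subset_G by blast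
      then show "C #> inv (q \<otimes> r) = C #> inv r #> inv q"
        using q Q'A Ac by (simp add: coset_mult_assoc inv_mult_group subset_iff)
    qed
    then have "{C \<in> E. \<forall>q\<in>Q'. C #> inv q = C} \<noteq> {}"
      using cE m(2) by (metis (no_types, lifting) Diff_empty)
    then obtain b where b: "b \<in> A" and fix_b: "\<And>q. q \<in> Q' \<Longrightarrow> Q #> b #> inv q = Q #> b"
      unfolding E_alt by blast
    have bc: "b \<in> carrier G" using b Ac by blast
    have into: "conjg G (b \<otimes> g) q \<in> Q" if q: "q \<in> Q" for q
    proof -
      let ?q = "conjg G g q"
      have qQ': "?q \<in> Q'" using q by (auto simp: Q'_def)
      have qc: "q \<in> carrier G" "?q \<in> carrier G" using q g Qc by auto
      have "Q #> (b \<otimes> inv ?q) = Q #> b"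
        using fix_b[OF qQ'] Qc bc qc by (simp add: coset_mult_assoc del: m_assoc)
      then have "b \<in> Q #> (b \<otimes> inv ?q)" using rcos_self[OF bc QG] by simp
      then obtain r where r: "r \<in> Q" "b = r \<otimes> (b \<otimes> inv ?q)" by (auto simp: r_coset_def)
      have rc: "r \<in> carrier G" using r Qc by blast
      have "b \<otimes> ?q = r \<otimes> b" 
        using r(2) rc bc qc by (metis inv_closed inv_solve_right m_assoc m_closed inv_inv)
      then have "conjg G b ?q = r" using rc bc qc by (simp add: inv_solve_right')
      then show ?thesis using conjg_conjg[OF bc g qc(1)] r by simp
    qed
    let ?h = "b \<otimes> g"
    have hc: "?h \<in> carrier G" using bc g by simp
    have "inj_on (conjg G ?h) Q" using hc conjg_inj Qc by (intro inj_onI) blast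
    then have surj: "conjg G ?h ` Q = Q" using into finQ by (metis endo_inj_surj image_subsetI)
    \<comment> \<open>Conjugation by \<open>b \<otimes> g\<close> maps \<open>Q\<close> onto itself
      and hence preserves its centre.\<close>
    have "conjg G ?h z \<in> Z" if z: "z \<in> Z" for z
    proof -
      have "conjg G q (conjg G ?h z) = conjg G ?h z" if "q \<in> Q" for q
      proof -
        obtain r where r: "r \<in> Q" "q = conjg G ?h r" using surj \<open>q \<in> Q\<close> by blast
        have rz: "r \<in> carrier G" "z \<in> carrier G" using r z Qc by (auto simp: Z_def)
        have "conjg G ?h (conjg G r z) = conjg G q (conjg G ?h z)"
          unfolding r(2) conjg_mult[OF hc m_closed[OF rz] inv_closed[OF rz(1)]]
            conjg_mult[OF hc rz] conjg_inv[OF hc rz(1)] ..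
        moreover have "conjg G r z = z" using r z by (auto simp: Z_def)
        ultimately show ?thesis by simp
      qed
      then show ?thesis using into z by (auto simp: Z_def)
    qed
    then show ?thesis using b by blast
  qed
  show thesis
  proof
    show "subgroup Z G" "Z \<noteq> {\<one>}" by fact+
    show "Z \<subseteq> A" using QA by (auto simp: Z_def)
    show "x \<otimes> y = y \<otimes> x" if "x \<in> Z" "y \<in> Z" for x y
      using that Qc comm_iff by (auto simp: Z_def subset_iff)
  qed (use conj in blast)
qed

end

section \<open>The matroid of minimal generating sets\<close>

text \<open>Sets replace tuples: a generating tuple of minimal length has distinct entries. The rank
  \<open>d\<close> is a parameter so that the quotient by the loops can be an instance with the same
  \<open>d\<close>.\<close>

locale exchange_group = group G for G (structure) +
  fixes d :: nat
  assumes finite_carrier: "finite (carrier G)"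
    and d_minimal: "\<And>S. S \<subseteq> carrier G \<Longrightarrow> generate G S = carrier G \<Longrightarrow> d \<le> card S"
    and d_attained: "\<exists>S. S \<subseteq> carrier G \<and> card S = d \<and> generate G S = carrier G"
    and exchange_ax: "\<And>X Y x. \<lbrakk>X \<subseteq> carrier G; card X = d; generate G X = carrier G;
          Y \<subseteq> carrier G; card Y = d; generate G Y = carrier G; x \<in> X\<rbrakk>
          \<Longrightarrow> \<exists>y\<in>Y. generate G (insert y (X - {x})) = carrier G"
begin

definition basis :: "'a set \<Rightarrow> bool" where
  "basis X \<longleftrightarrow> X \<subseteq> carrier G \<and> card X = d \<and> generate G X = carrier G"

definition indep :: "'a set \<Rightarrow> bool" where
  "indep I \<longleftrightarrow> (\<exists>X. basis X \<and> I \<subseteq> X)"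

definition hyper :: "'a set \<Rightarrow> bool" where
  "hyper I \<longleftrightarrow> indep I \<and> Suc (card I) = d"

text \<open>The hyperplane spanned by \<open>I\<close> in the matroid whose bases are the generating sets of
  size \<open>d\<close>.\<close>

definition flat :: "'a set \<Rightarrow> 'a set" where
  "flat I = {v. indep {v} \<and> \<not> basis (insert v I)}"

text \<open>For \<open>d \<ge> 2\<close> these are the elements lying in no basis, that is, the loops of the matroid;
  stated in this form they visibly form a normal subgroup of non-generators.\<close>

definition loops :: "'a set" where
  "loops = {a \<in> carrier G. \<forall>X x. basis X \<longrightarrow> x \<in> X \<longrightarrow> basis (insert (a \<otimes> x) (X - {x}))}"

section \<open>Bases and elementary moves on them\<close>

lemma basis_finite: "basis X \<Longrightarrow> finite X"
  using finite_carrier finite_subset by (auto simp: basis_def)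

lemma basis_carrier: "basis X \<Longrightarrow> X \<subseteq> carrier G"
  by (simp add: basis_def)

lemma basis_card: "basis X \<Longrightarrow> card X = d"
  by (simp add: basis_def)

lemma basis_exists: "\<exists>X. basis X"
  using d_attained by (auto simp: basis_def)

text \<open>Fewer than \<open>d\<close> elements never generate, so an upper bound on the
  cardinality is enough; a substitution in a basis need not be checked for collisions
  beforehand.\<close>

lemma gen_basis:
  assumes "S \<subseteq> carrier G" "generate G S = carrier G" "card S \<le> d"
  shows "basis S"
  using assms d_minimal[OF assms(1,2)] by (simp add: basis_def)

lemma card_insert_Diff_le: "finite X \<Longrightarrow> x \<in> X \<Longrightarrow> card (insert y (X - {x})) \<le> card X"
  using card_Suc_Diff1[of X x] card_insert_if[of "X - {x}" y] by (auto split: if_splits)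

lemma exchange:
  assumes X: "basis X" and Y: "basis Y" and x: "x \<in> X"
  shows "\<exists>y\<in>Y. basis (insert y (X - {x}))"
proof -
  obtain y where y: "y \<in> Y" "generate G (insert y (X - {x})) = carrier G"
    using exchange_ax[of X Y x] assms by (auto simp: basis_def)
  have "basis (insert y (X - {x}))"
    by (rule gen_basis)
      (use y X Y x card_insert_Diff_le[OF basis_finite[OF X] x] in \<open>auto simp: basis_def\<close>)
  then show ?thesis using y by blast
qed

lemma basis_redundant:
  assumes "basis X" "x \<in> X"
  shows "x \<notin> generate G (X - {x})"
proof
  assume x: "x \<in> generate G (X - {x})"
  have c: "X - {x} \<subseteq> carrier G" using assms basis_carrier by blast
  have "X \<subseteq> generate G (X - {x})" using x by (auto intro: generate.incl)
  from generate_subgroup_incl[OF this generate_is_subgroup[OF c]]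
  have "carrier G \<subseteq> generate G (X - {x})" using assms by (simp add: basis_def)
  then have "generate G (X - {x}) = carrier G" using generate_incl[OF c] by blast
  then have "d \<le> card (X - {x})" using d_minimal c by blast
  then show False using assms basis_finite[OF assms(1)] by (metis basis_card card_Diff1_less not_le)
qed

text \<open>The elementary moves rest on this criterion: if the discarded \<open>x\<close> can be
  recovered from the new set, nothing is lost from the generated subgroup.\<close>

lemma basis_subst:
  assumes "basis X" "x \<in> X" "y \<in> carrier G" "x \<in> generate G (insert y (X - {x}))"
  shows "basis (insert y (X - {x}))"
proof (rule gen_basis)
  show c: "insert y (X - {x}) \<subseteq> carrier G" using assms basis_carrier by blast
  have "X \<subseteq> generate G (insert y (X - {x}))" using assms(4) by (auto intro: generate.incl)
  from generate_subgroup_incl[OF this generate_is_subgroup[OF c]]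
  have "carrier G \<subseteq> generate G (insert y (X - {x}))" using assms by (simp add: basis_def)
  then show "generate G (insert y (X - {x})) = carrier G" using generate_incl[OF c] by blast
  show "card (insert y (X - {x})) \<le> d"
    using card_insert_Diff_le[OF basis_finite[OF assms(1)] assms(2)] assms(1) basis_card by metis
qed

lemma basis_insert_notin:
  assumes "basis X" "x \<in> X" "basis (insert y (X - {x}))"
  shows "y \<notin> X - {x}"
proof
  assume "y \<in> X - {x}"
  then have "basis (X - {x})" using assms(3) by (simp add: insert_absorb)
  then show False using assms(1,2) basis_finite[OF assms(1)]
    by (metis basis_card card_Diff1_less less_irrefl)
qed

lemma one_not_in_basis: "basis X \<Longrightarrow> \<one> \<notin> X"
  using basis_redundant generate.one by blast

lemma basis_mult_left:
  assumes "basis X" "x \<in> X" "u \<in> X" "u \<noteq> x"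
  shows "basis (insert (u \<otimes> x) (X - {x}))"
proof -
  have c: "x \<in> carrier G" "u \<in> carrier G" using assms basis_carrier by blast+
  let ?S = "insert (u \<otimes> x) (X - {x})"
  have S: "?S \<subseteq> carrier G" using assms(1) c basis_carrier by auto
  have "u \<in> generate G ?S" "u \<otimes> x \<in> generate G ?S" using assms by (auto intro: generate.incl)
  then have "inv u \<otimes> (u \<otimes> x) \<in> generate G ?S" using generate_closed[OF S] by blast
  then show ?thesis using assms c by (intro basis_subst) auto
qed

lemma basis_mult_right:
  assumes "basis X" "x \<in> X" "u \<in> X" "u \<noteq> x"
  shows "basis (insert (x \<otimes> u) (X - {x}))"
proof -
  have c: "x \<in> carrier G" "u \<in> carrier G" using assms basis_carrier by blast+
  let ?S = "insert (x \<otimes> u) (X - {x})"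
  have S: "?S \<subseteq> carrier G" using assms(1) c basis_carrier by auto
  have "u \<in> generate G ?S" "x \<otimes> u \<in> generate G ?S" using assms by (auto intro: generate.incl)
  then have "(x \<otimes> u) \<otimes> inv u \<in> generate G ?S" using generate_closed[OF S] by blast
  then show ?thesis using assms c by (intro basis_subst) (auto simp: m_assoc)
qed

lemma basis_inv:
  assumes "basis X" "x \<in> X"
  shows "basis (insert (inv x) (X - {x}))"
proof -
  have c: "x \<in> carrier G" using assms basis_carrier by blast
  let ?S = "insert (inv x) (X - {x})"
  have S: "?S \<subseteq> carrier G" using assms(1) c basis_carrier by auto
  have "inv (inv x) \<in> generate G ?S" using generate_closed(2)[OF S] by (blast intro: generate.incl)
  then show ?thesis using assms c by (intro basis_subst) auto
qed

lemma basis_conjg: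
  assumes "basis X" "g \<in> carrier G"
  shows "basis (conjg G g ` X)"
proof -
  interpret cg: group_hom G G "conjg G g" using group_hom_conjg[OF assms(2)] .
  have inj: "inj_on (conjg G g) X"
    using assms basis_carrier by (intro inj_onI) (metis conjg_inj subsetD)
  have "conjg G g ` carrier G = carrier G"
  proof
    show "carrier G \<subseteq> conjg G g ` carrier G"
    proof
      fix x assume "x \<in> carrier G"
      then show "x \<in> conjg G g ` carrier G"
        using assms(2) conjg_inv_cancel(2)[of g x]
        by (intro image_eqI[of _ _ "conjg G (inv g) x"]) auto
    qed
  qed (use assms in auto)
  then show ?thesis
    using assms cg.generate_img[of X] card_image[OF inj] by (auto simp: basis_def)
qed

section \<open>Independent sets, hyperplanes and the subgroups they generate\<close>

lemma indepE: "indep I \<Longrightarrow> (\<And>X. basis X \<Longrightarrow> I \<subseteq> X \<Longrightarrow> P) \<Longrightarrow> P"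
  by (auto simp: indep_def)

lemma indep_carrier: "indep I \<Longrightarrow> I \<subseteq> carrier G"
  using basis_carrier by (auto simp: indep_def)

lemma indep_finite: "indep I \<Longrightarrow> finite I"
  using basis_finite finite_subset by (auto simp: indep_def)

lemma basis_indep: "basis X \<Longrightarrow> I \<subseteq> X \<Longrightarrow> indep I"
  by (auto simp: indep_def)

text \<open>Start from a basis containing \<open>I\<close> and exchange an element outside
  \<open>I \<union> Y\<close> against \<open>Y\<close>. Each exchange lowers the number of such
  elements and never touches \<open>I\<close>.\<close>

lemma augment:
  assumes "indep I" and Y: "basis Y"
  obtains Z where "basis Z" "I \<subseteq> Z" "Z \<subseteq> I \<union> Y"
proof -
  have *: "\<exists>Z. basis Z \<and> I \<subseteq> Z \<and> Z \<subseteq> I \<union> Y" if "basis X" "I \<subseteq> X" for X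
    using that
  proof (induction "card (X - I - Y)" arbitrary: X rule: less_induct)
    case less
    show ?case
    proof (cases "X \<subseteq> I \<union> Y")
      case False
      then obtain x where x: "x \<in> X" "x \<notin> I" "x \<notin> Y" by blast
      obtain y where y: "y \<in> Y" "basis (insert y (X - {x}))" using exchange[OF less.prems(1) Y x(1)] by blast
      have "insert y (X - {x}) - I - Y = (X - I - Y) - {x}" using y(1) by auto
      then have "card (insert y (X - {x}) - I - Y) < card (X - I - Y)"
        using basis_finite[OF less.prems(1)] x by (simp only:) (intro card_Diff1_less, auto)
      moreover have "I \<subseteq> insert y (X - {x})" using less.prems(2) x by blast
      ultimately show ?thesis using less.hyps y(2) by metis
    next
      case True then show ?thesis using less.prems by metis
    qed
  qed
  obtain X where "basis X" "I \<subseteq> X" using assms(1) by (rule indepE)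
  from *[OF this] show thesis using that by metis
qed

lemma hyper_not_basis: "hyper I \<Longrightarrow> \<not> basis I"
  by (metis basis_card hyper_def n_not_Suc_n)

lemma basis_hyper: "basis X \<Longrightarrow> x \<in> X \<Longrightarrow> hyper (X - {x})"
  by (metis Diff_subset basis_card basis_finite basis_indep card_Suc_Diff1 hyper_def)

lemma hyper_card_insert: "hyper I \<Longrightarrow> card (insert v I) \<le> d"
  by (simp add: hyper_def card_insert_if indep_finite)

lemma hyper_augment:
  assumes I: "hyper I" and Y: "basis Y"
  obtains y where "y \<in> Y" "basis (insert y I)"
proof -
  obtain Z where Z: "basis Z" "I \<subseteq> Z" "Z \<subseteq> I \<union> Y"
    using augment[OF _ Y] I by (auto simp: hyper_def)
  then obtain y where y: "y \<in> Z" "y \<notin> I" using Z hyper_not_basis[OF I] by (metis subsetI subset_antisym)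
  have "insert y I = Z"
    using Z y I by (intro card_subset_eq) (auto simp: basis_finite basis_card hyper_def indep_finite)
  then show thesis using that Z y by blast
qed

text \<open>Up to a basis exchange \<open>x\<close> may be assumed to lie in \<open>I\<close>.\<close>

lemma hyper_mult:
  assumes I: "hyper I" and x: "x \<in> flat I" and y: "basis (insert y I)"
  shows "basis (insert (x \<otimes> y) I)" "basis (insert (y \<otimes> x) I)"
proof -
  have nI: "\<not> basis (insert x I)" and ix: "indep {x}" using x by (auto simp: flat_def)
  have yI: "y \<notin> I" using y hyper_not_basis[OF I] by (auto simp: insert_absorb)
  have xy: "x \<noteq> y" using y nI by blast
  have c: "x \<in> carrier G" "y \<in> carrier G" using ix y indep_carrier basis_carrier by auto
  obtain Z where "basis Z" "{x} \<subseteq> Z" "Z \<subseteq> {x} \<union> insert y I"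
    using augment[OF ix y] .
  then have Z: "basis Z" "x \<in> Z" "Z \<subseteq> insert x (insert y I)" by auto
  have yZ: "y \<in> Z"
  proof (rule ccontr)
    assume "y \<notin> Z"
    then have "Z \<subseteq> insert x I" using Z by blast
    then have "Z = insert x I"
      using hyper_card_insert[OF I, of x] Z I
      by (intro card_seteq) (auto simp: basis_card hyper_def indep_finite)
    then show False using nI Z by simp
  qed
  \<comment> \<open>All elements of \<open>Z - {y}\<close> lie in \<open>insert x I\<close> and none
    of them completes \<open>I\<close>. Completing \<open>I\<close> from the basis
    \<open>insert w (Z - {y})\<close> can therefore only use \<open>w\<close>.\<close>
  have *: "basis (insert w I)" if w: "basis (insert w (Z - {y}))" for w
  proof -
    obtain v where v: "v \<in> insert w (Z - {y})" "basis (insert v I)"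
      using hyper_augment[OF I w] .
    have "v \<notin> insert x I" using v nI hyper_not_basis[OF I] by (auto simp: insert_absorb)
    then have "v = w" using v Z by blast
    then show ?thesis using v by simp
  qed
  show "basis (insert (x \<otimes> y) I)" "basis (insert (y \<otimes> x) I)"
    by (rule *, rule basis_mult_left basis_mult_right, use Z yZ xy in auto)+
qed

lemma flat_carrier: "flat I \<subseteq> carrier G"
  using indep_carrier by (auto simp: flat_def)

lemma indep_inv:
  assumes "indep {v}" shows "indep {inv v}"
proof -
  obtain X where X: "basis X" "v \<in> X" using assms by (auto simp: indep_def)
  show ?thesis by (rule basis_indep[OF basis_inv[OF X]]) auto
qed

lemma hyper_insert_inv:
  assumes I: "hyper I" "basis (insert v I)"
  shows "basis (insert (inv v) I)"
proof -
  have "v \<notin> I" using I hyper_not_basis[OF I(1)] by (auto simp: insert_absorb)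
  then show ?thesis using basis_inv[OF I(2), of v] by simp
qed

lemma flat_inv:
  assumes I: "hyper I" and v: "v \<in> flat I"
  shows "inv v \<in> flat I"
proof -
  have "v \<in> carrier G" using v flat_carrier by blast
  then show ?thesis using v indep_inv[of v] hyper_insert_inv[OF I, of "inv v"]
    by (auto simp: flat_def)
qed

text \<open>One multiplication by an element of the flat or its inverse is
  \<open>hyper_mult\<close>; induction over words extends it. The elements completing
  \<open>I\<close> thus form a union of right cosets of the subgroup generated by the flat.\<close>

lemma generate_flat_mult:
  assumes I: "hyper I" and a: "a \<in> generate G (flat I)" and y: "basis (insert y I)"
  shows "basis (insert (a \<otimes> y) I)"
  using a y
proof (induction arbitrary: y)
  case one
  then show ?case using basis_carrier[OF one] by simp
next
  case (incl h) then show ?case using hyper_mult[OF I] by blast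
next
  case (inv h) then show ?case using hyper_mult[OF I] flat_inv[OF I] by blast
next
  case (eng h1 h2)
  have "h1 \<in> carrier G" "h2 \<in> carrier G" "y \<in> carrier G"
    using eng generate_incl[OF flat_carrier] basis_carrier[OF eng.prems] by auto
  then show ?case using eng by (simp add: m_assoc)
qed

text \<open>If \<open>a\<close> completed \<open>I\<close>, so would \<open>inv a\<close>, and then
  also \<open>a \<otimes> inv a\<close>; but \<one> lies in no basis.\<close>

lemma generate_flat_proper:
  assumes I: "hyper I" and a: "a \<in> generate G (flat I)"
  shows "\<not> basis (insert a I)"
proof
  assume b: "basis (insert a I)"
  then have ac: "a \<in> carrier G" using basis_carrier by blast
  have "basis (insert (a \<otimes> inv a) I)"
    by (rule generate_flat_mult[OF I a hyper_insert_inv[OF I b]])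
  from one_not_in_basis[OF this] show False using ac by simp
qed

text \<open>Extending \<open>{w}\<close> from \<open>X\<close> drops one element of
  \<open>X\<close>. Since \<open>w\<close> and \<open>y\<close> share no basis, the dropped element
  is \<open>y\<close>.\<close>

lemma parallel_subst:
  assumes X: "basis X" "y \<in> X" and w: "indep {w}" and parallel: "w = y \<or> \<not> indep {w, y}"
  shows "basis (insert w (X - {y}))"
proof (cases "w = y")
  case True then show ?thesis using X by (simp add: insert_absorb)
next
  case False
  obtain Z where Z: "basis Z" "w \<in> Z" "Z \<subseteq> insert w X"
    using augment[OF w X(1)] by auto
  have "y \<notin> Z" using Z parallel False basis_indep[of Z "{w,y}"] by auto
  then have "Z \<subseteq> insert w (X - {y})" using Z by blast
  then have "Z = insert w (X - {y})"
    using card_insert_Diff_le[OF basis_finite[OF X(1)] X(2), of w] Z X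
    by (intro card_seteq) (auto simp: basis_card basis_finite)
  then show ?thesis using Z by simp
qed

text \<open>In a basis containing both \<open>a \<otimes> y\<close> and \<open>y\<close>, the former
  may be replaced by \<open>a\<close>.\<close>

lemma indep_pair_left:
  assumes "indep {a \<otimes> y, y}" "a \<otimes> y \<noteq> y" "a \<in> carrier G"
  shows "indep {a}"
proof -
  obtain X where X: "basis X" "a \<otimes> y \<in> X" "y \<in> X" using assms(1) by (auto simp: indep_def)
  have yc: "y \<in> carrier G" using X basis_carrier by blast
  let ?S = "insert a (X - {a \<otimes> y})"
  have S: "?S \<subseteq> carrier G" using X(1) assms basis_carrier by auto
  have "a \<otimes> y \<in> generate G ?S"
    by (rule generate.eng) (use X assms in \<open>auto intro!: generate.incl\<close>)
  then have "basis ?S" using X assms by (intro basis_subst) auto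
  then show ?thesis by (rule basis_indep) auto
qed

lemma indep_pair_mult:
  assumes "indep {x, y}" "x \<noteq> y"
  shows "indep {x, x \<otimes> y}" "indep {x, y \<otimes> x}"
proof -
  obtain X where X: "basis X" "x \<in> X" "y \<in> X" using assms(1) by (auto simp: indep_def)
  show "indep {x, x \<otimes> y}" 
    by (rule basis_indep[OF basis_mult_left[OF X(1,3,2) assms(2)]]) (use X assms in auto)
  show "indep {x, y \<otimes> x}" 
    by (rule basis_indep[OF basis_mult_right[OF X(1,3,2) assms(2)]]) (use X assms in auto)
qed

text \<open>If \<open>y\<close> completes \<open>I\<close>, so does \<open>a \<otimes> y\<close>. A
  common basis of two distinct such elements would put \<open>a\<close> into a basis, so
  \<open>y\<close> and \<open>a \<otimes> y\<close> are parallel and interchangeable. The remaining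
  elements of a basis are treated by changing the hyperplane.\<close>

lemma flat_loops:
  assumes I: "hyper I" and a: "a \<in> generate G (flat I)" and na: "\<not> indep {a}"
  shows "a \<in> loops"
proof -
  have ac: "a \<in> carrier G" using a generate_incl[OF flat_carrier] by blast
  have parallel: "indep {a \<otimes> y}" "a \<otimes> y = y \<or> \<not> indep {a \<otimes> y, y}" if "basis (insert y I)" for y
    using generate_flat_mult[OF I a that] basis_indep[of "insert (a \<otimes> y) I"] 
      indep_pair_left[OF _ _ ac, of y] na by auto
  have "basis (insert (a \<otimes> y) (X - {y}))" if X: "basis X" "y \<in> X" for X y
  proof (cases "basis (insert y I)")
    case True
    then show ?thesis using parallel_subst[OF X] parallel by blast
  next
    case False
    \<comment> \<open>The element \<open>y'\<close> completes \<open>I\<close>, so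
      \<open>a \<otimes> y'\<close> is parallel to it. Both lie in the flat of
      \<open>J = X - {y}\<close>, hence \<open>a\<close> is in the subgroup generated by that flat,
      and multiplying \<open>y\<close>, which completes \<open>J\<close>, by \<open>a\<close> gives
      a basis again.\<close>
    obtain y' where y': "y' \<in> X" "basis (insert y' I)" using hyper_augment[OF I X(1)] .
    have yy: "y' \<noteq> y" using y' False by blast
    define J where "J = X - {y}"
    have J: "hyper J" unfolding J_def using basis_hyper[OF X] .
    have y'J: "y' \<in> J" using y' yy by (simp add: J_def)
    have "y' \<in> flat J"
      using y' hyper_not_basis[OF J] y'J X basis_indep[OF X(1), of "{y'}"]
      by (auto simp: flat_def insert_absorb)
    moreover have "a \<otimes> y' \<in> flat J"
    proof -
      have "\<not> basis (insert (a \<otimes> y') J)"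
      proof
        assume b: "basis (insert (a \<otimes> y') J)"
        then have "indep {a \<otimes> y', y'}" using y'J by (auto intro: basis_indep)
        then have "a \<otimes> y' = y'" using parallel[OF y'(2)] by blast
        then show False using b y'J hyper_not_basis[OF J] by (simp add: insert_absorb)
      qed
      then show ?thesis using parallel[OF y'(2)] by (simp add: flat_def)
    qed
    ultimately have "(a \<otimes> y') \<otimes> inv y' \<in> generate G (flat J)"
      by (intro generate.eng generate.incl generate.inv)
    moreover have "(a \<otimes> y') \<otimes> inv y' = a"
      using ac y' basis_carrier[OF X(1)] by (simp add: m_assoc subset_iff)
    ultimately have "a \<in> generate G (flat J)" by simp
    then show ?thesis
      using generate_flat_mult[OF J, of a y] X by (simp add: J_def insert_absorb)
  qed
  then show ?thesis using ac by (simp add: loops_def)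
qed

section \<open>The normal subgroup of loops as non-generators\<close>

lemma loopsD: "a \<in> loops \<Longrightarrow> basis X \<Longrightarrow> x \<in> X \<Longrightarrow> basis (insert (a \<otimes> x) (X - {x}))"
  by (simp add: loops_def)

lemma loops_carrier: "loops \<subseteq> carrier G"
  by (auto simp: loops_def)

lemma loops_subgroup: "subgroup loops G"
proof (rule finite_submonoid_is_subgroup)
  show "loops \<subseteq> carrier G" by (rule loops_carrier)
  then show "finite loops" using finite_carrier finite_subset by blast
  show "\<one> \<in> loops" using basis_carrier by (auto simp: loops_def insert_absorb subset_iff)
  fix a b assume a: "a \<in> loops" and b: "b \<in> loops"
  have "basis (insert (a \<otimes> b \<otimes> x) (X - {x}))" if X: "basis X" "x \<in> X" for X x
  proof -
    have bx: "basis (insert (b \<otimes> x) (X - {x}))" using loopsD[OF b X] .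
    have "b \<otimes> x \<notin> X - {x}" using basis_insert_notin[OF X bx] .
    then show ?thesis using loopsD[OF a bx, of "b \<otimes> x"] a b X loops_carrier basis_carrier[OF X(1)]
      by (simp add: m_assoc subset_iff)
  qed
  then show "a \<otimes> b \<in> loops" using a b loops_carrier by (auto simp: loops_def)
qed

text \<open>Conjugation preserves bases: move \<open>X\<close> by \<open>inv g\<close>, multiply
  there by \<open>a\<close>, and move back.\<close>

lemma loops_normal: "loops \<lhd> G"
proof (rule normal_invI[OF loops_subgroup])
  fix g a assume g: "g \<in> carrier G" and a: "a \<in> loops"
  have ac: "a \<in> carrier G" using a loops_carrier by blast
  have "basis (insert (conjg G g a \<otimes> x) (X - {x}))" if X: "basis X" "x \<in> X" for X x
  proof -
    have Xc: "X \<subseteq> carrier G" "x \<in> carrier G" using X basis_carrier by blast+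
    let ?c = "conjg G (inv g)"
    have "basis (insert (a \<otimes> ?c x) (?c ` X - {?c x}))"
      using loopsD[OF a basis_conjg[OF X(1), of "inv g"]] X g by blast
    then have *: "basis (conjg G g ` (insert (a \<otimes> ?c x) (?c ` X - {?c x})))"
      using basis_conjg g by blast
    have "conjg G g ` (?c ` X - {?c x}) = X - {x}"
    proof -
      have "?c ` X - {?c x} = ?c ` (X - {x})"
        using Xc g by (auto simp del: inv_inv)
      moreover have "conjg G g ` ?c ` (X - {x}) = X - {x}"
      proof -
        have "conjg G g (?c w) = w" if "w \<in> X - {x}" for w
          using that Xc by (intro conjg_inv_cancel(2) g) auto
        then show ?thesis unfolding image_image by simp
      qed
      ultimately show ?thesis by simp
    qed
    moreover have "conjg G g (a \<otimes> ?c x) = conjg G g a \<otimes> x"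
      using g ac Xc by (simp add: m_assoc)
    ultimately show ?thesis using * by simp
  qed
  then show "conjg G g a \<in> loops" using g ac by (simp add: loops_def)
qed

text \<open>The union of the two sets contains every basis and is closed under multiplication.\<close>

lemma indep_or_loop:
  assumes d: "d \<ge> 2" and g: "g \<in> carrier G"
  shows "indep {g} \<or> g \<in> loops"
proof -
  interpret L: normal loops G by (rule loops_normal)
  have Lmult: "indep {a \<otimes> v}" if "a \<in> loops" "indep {v}" for a v
  proof -
    obtain X where X: "basis X" "v \<in> X" using \<open>indep {v}\<close> by (auto simp: indep_def)
    show ?thesis by (rule basis_indep[OF loopsD[OF that(1) X]]) auto
  qed
  have Vmult: "indep {x \<otimes> y} \<or> x \<otimes> y \<in> loops" if x: "indep {x}" and y: "indep {y}" for x y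
  proof (cases "indep {x \<otimes> y}")
    case False
    obtain X where X: "basis X" "x \<in> X" using x by (auto simp: indep_def)
    have dep: "x = y \<or> \<not> indep {x, y}"
      using False indep_pair_mult(1)[of x y] by (auto simp: indep_def)
    have "X \<noteq> {x}" using basis_card[OF X(1)] d by auto
    \<comment> \<open>Here \<open>d \<ge> 2\<close> enters: it provides a hyperplane
      \<open>X - {z}\<close> containing \<open>x\<close>. As \<open>y\<close> is parallel to
      \<open>x\<close>, its flat contains \<open>y\<close> too, so \<open>x \<otimes> y\<close>
      falls under \<open>flat_loops\<close>.\<close>
    then obtain z where z: "z \<in> X" "z \<noteq> x" using X by blast
    let ?I = "X - {z}"
    have I: "hyper ?I" using basis_hyper[OF X(1) z(1)] .
    have "x \<in> flat ?I" using x hyper_not_basis[OF I] X z by (simp add: flat_def insert_absorb)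
    moreover have "y \<in> flat ?I"
    proof -
      have "\<not> basis (insert y ?I)"
        using basis_indep[of "insert y ?I" "{x, y}"] dep X z hyper_not_basis[OF I] 
        by (auto simp: insert_absorb)
      then show ?thesis using y by (simp add: flat_def)
    qed
    ultimately have "x \<otimes> y \<in> generate G (flat ?I)" by (intro generate.eng generate.incl)
    then show ?thesis using flat_loops[OF I] by blast
  qed simp
  have "indep {g} \<or> g \<in> loops" if "g \<in> generate G X" "basis X" for X
    using that
  proof (induction)
    case (incl h) then show ?case using basis_indep[of X "{h}"] by simp
  next
    case (inv h) then show ?case using basis_indep[of X "{h}"] indep_inv by simp
  next
    case (eng x y)
    have c: "x \<in> carrier G" "y \<in> carrier G" using eng generate_incl[OF basis_carrier] by blast+
    \<comment> \<open>By normality a loop on the right can be moved to the left, where the defining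
      property of loops applies.\<close>
    have "indep {x \<otimes> y} \<or> x \<otimes> y \<in> loops" if "indep {x}" "y \<in> loops"
    proof -
      have "conjg G x y \<in> loops" using L.inv_op_closed2[OF c(1)] that by blast
      then have "indep {conjg G x y \<otimes> x}" using Lmult that by blast
      then show ?thesis using c by (simp add: m_assoc)
    qed
    then show ?case using eng Vmult Lmult by blast
  qed simp
  then show ?thesis using basis_exists g by (auto simp: basis_def)
qed

text \<open>Replacing the elements of a basis outside \<open>H\<close> one at a time ends with a
  basis inside \<open>H\<close>. This serves both for discarding loops and for generation from the
  normal points.\<close>

lemma subgroup_absorbs_basis:
  assumes H: "subgroup H G"
    and r: "\<And>X x. basis X \<Longrightarrow> x \<in> X \<Longrightarrow> x \<notin> H \<Longrightarrow> \<exists>h\<in>H. basis (insert h (X - {x}))"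
  shows "H = carrier G"
proof -
  have Hc: "H \<subseteq> carrier G" using subgroup.subset[OF H] .
  have "\<exists>Z. basis Z \<and> Z \<subseteq> H" if "basis X" for X
    using that
  proof (induction "card (X - H)" arbitrary: X rule: less_induct)
    case less
    show ?case
    proof (cases "X \<subseteq> H")
      case False
      then obtain x where x: "x \<in> X" "x \<notin> H" by blast
      obtain h where h: "h \<in> H" "basis (insert h (X - {x}))" using r[OF less.prems x] by blast
      have "insert h (X - {x}) - H = (X - H) - {x}" using h(1) by auto
      then have "card (insert h (X - {x}) - H) < card (X - H)"
        using basis_finite[OF less.prems] x by (simp only:) (intro card_Diff1_less, auto)
      from less.hyps[OF this h(2)] show ?thesis .
    next
      case True then show ?thesis using less.prems by metis
    qed
  qed
  then obtain Z where Z: "basis Z" "Z \<subseteq> H" using basis_exists by blast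
  then have "carrier G \<subseteq> H" using generate_subgroup_incl[OF Z(2) H] by (simp add: basis_def)
  then show ?thesis using Hc by blast
qed

lemma loops_nongenerating:
  assumes H: "subgroup H G" and n: "\<And>g. g \<in> carrier G \<Longrightarrow> \<exists>a\<in>loops. a \<otimes> g \<in> H"
  shows "H = carrier G"
proof (rule subgroup_absorbs_basis[OF H])
  fix X x assume X: "basis X" "x \<in> X"
  then obtain a where "a \<in> loops" "a \<otimes> x \<in> H" using n basis_carrier by blast
  then show "\<exists>h\<in>H. basis (insert h (X - {x}))" using loopsD X by blast
qed

end

section \<open>Solvability of the loops and passage to the quotient\<close>

context group
begin

text \<open>The derived series of \<open>H\<close> enters that of \<open>M\<close> after one
  step.\<close>

lemma solvable_seq_derived_le:
  assumes H: "subgroup H G" and M: "solvable_seq G M" and le: "derived G H \<subseteq> M"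
  shows "solvable_seq G H"
proof -
  obtain n where n: "(derived G ^^ n) M = {\<one>}"
    using solvable_imp_trivial_derived_seq[OF M] by blast
  have "(derived G ^^ Suc n) H = (derived G ^^ n) (derived G H)"
    by (simp add: funpow_swap1)
  then have "(derived G ^^ Suc n) H \<subseteq> {\<one>}"
    using mono_exp_of_derived[OF le, of n] n by simp
  moreover have "\<one> \<in> (derived G ^^ Suc n) H"
    using subgroup.one_closed[OF exp_of_derived_is_subgroup[OF H]] .
  ultimately show ?thesis
    using trivial_derived_seq_imp_solvable[OF H, of "Suc n"] by blast
qed

lemma abelian_solvable_seq:
  assumes K: "subgroup K G" and ab: "\<And>x y. x \<in> K \<Longrightarrow> y \<in> K \<Longrightarrow> x \<otimes> y = y \<otimes> x"
  shows "solvable_seq G K"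
proof (rule solvable_seq_derived_le[OF K solvable_seq.unity])
  have Kc: "K \<subseteq> carrier G" using subgroup.subset[OF K] .
  have "derived_set G K \<subseteq> {\<one>}"
  proof clarify
    fix x y assume "x \<in> K" "y \<in> K"
    moreover then have "x \<in> carrier G" "y \<in> carrier G" using Kc by auto
    ultimately show "x \<otimes> y \<otimes> inv x \<otimes> inv y = \<one>"
      using ab[of x y] by (simp add: m_assoc)
  qed
  then show "derived G K \<subseteq> {\<one>}"
    unfolding derived_def
    using generate_subgroup_incl[OF _ normal_imp_subgroup[OF one_is_normal]] by blast
qed

text \<open>Centralizers are subgroups, which is used twice: the subgroup generated by
  \<open>S\<close> centralizes \<open>S\<close>, so \<open>S\<close> and with it the generated
  subgroup centralizes the generated subgroup.\<close>

lemma generate_commute: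
  assumes S: "S \<subseteq> carrier G" and com: "\<And>u v. u \<in> S \<Longrightarrow> v \<in> S \<Longrightarrow> u \<otimes> v = v \<otimes> u"
    and x: "x \<in> generate G S" and y: "y \<in> generate G S"
  shows "x \<otimes> y = y \<otimes> x"
proof -
  let ?C = "\<lambda>U. {z \<in> carrier G. \<forall>u\<in>U. conjg G z u = u}"
  have com_iff: "conjg G z u = u \<longleftrightarrow> z \<otimes> u = u \<otimes> z" if "z \<in> carrier G" "u \<in> carrier G" for z u
    using that by (metis inv_closed inv_solve_right m_closed)
  have cent: "subgroup (?C U) G" if U: "U \<subseteq> carrier G" for U
  proof (rule subgroupI)
    show "?C U \<noteq> {}" using U by (auto intro!: exI[of _ \<one>])
    fix a assume a: "a \<in> ?C U"
    have "conjg G (inv a) u = u" if "u \<in> U" for u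
      using conjg_inv_cancel(1)[of a u] a U that by auto
    then show "inv a \<in> ?C U" using a by simp
    fix b assume "b \<in> ?C U"
    then show "a \<otimes> b \<in> ?C U" using a U conjg_conjg[of a b] by auto
  qed auto
  have "S \<subseteq> ?C S" using S com com_iff by (simp add: subset_iff)
  then have "generate G S \<subseteq> ?C S" by (rule generate_subgroup_incl[OF _ cent[OF S]])
  moreover have gc: "generate G S \<subseteq> carrier G" using generate_incl[OF S] .
  ultimately have "S \<subseteq> ?C (generate G S)" using S com_iff by (auto simp: subset_iff)
  then have "generate G S \<subseteq> ?C (generate G S)" by (rule generate_subgroup_incl[OF _ cent[OF gc]])
  then show ?thesis using x y gc com_iff[of x y] by auto
qed

lemma group_hom_rcoset: "N \<lhd> G \<Longrightarrow> group_hom G (G Mod N) ((#>) N)"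
  by (simp add: group_hom_def group_hom_axioms_def group_axioms normal.factorgroup_is_group
      normal.r_coset_hom_Mod)

lemma rcoset_eq_self_iff:
  assumes "subgroup N G" "x \<in> carrier G"
  shows "N #> x = N \<longleftrightarrow> x \<in> N"
  using assms rcos_self coset_join2 by metis

lemma rcoset_eqD:
  assumes N: "subgroup N G" and c: "x \<in> carrier G" "y \<in> carrier G" and eq: "N #> x = N #> y"
  obtains n where "n \<in> N" "y = n \<otimes> x"
proof -
  have "y \<in> N #> x" using rcos_self[OF c(2) N] eq by simp
  then show thesis using that by (auto simp: r_coset_def)
qed

text \<open>The quotient by \<open>K\<close> is generated by the coset of \<open>h\<close>, hence
  abelian, so the derived subgroup of \<open>G\<close> lies in the abelian \<open>K\<close>.\<close>

lemma solvable_cyclic_extension: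
  assumes K: "K \<lhd> G" and ab: "\<And>x y. x \<in> K \<Longrightarrow> y \<in> K \<Longrightarrow> x \<otimes> y = y \<otimes> x"
    and h: "h \<in> carrier G" and gen: "generate G (insert h K) = carrier G"
  shows "solvable G"
proof -
  interpret K: normal K G by (rule K)
  interpret q: group_hom G "G Mod K" "(#>) K" by (rule group_hom_rcoset[OF K])
  let ?Q = "G Mod K"
  have fh: "K #> h \<in> carrier ?Q" using h by simp
  have "(#>) K ` insert h K \<subseteq> generate ?Q {K #> h}"
    using K.rcos_const by (auto intro: generate.incl generate.one[of ?Q, simplified])
  then have "generate ?Q ((#>) K ` insert h K) \<subseteq> generate ?Q {K #> h}"
    using q.H.generate_subgroup_incl[OF _ q.H.generate_is_subgroup] fh by blast
  then have "carrier ?Q \<subseteq> generate ?Q {K #> h}"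
    using q.generate_img[of "insert h K"] gen h K.subset by (simp add: carrier_FactGroup)
  then have pow: "\<exists>k::int. x = (K #> h) [^]\<^bsub>?Q\<^esub> k" if "x \<in> carrier ?Q" for x
    using that q.H.generate_pow[OF fh] by auto
  have "comm_group ?Q"
  proof (rule q.H.group_comm_groupI)
    fix x y assume "x \<in> carrier ?Q" "y \<in> carrier ?Q"
    then obtain k l :: int where "x = (K #> h) [^]\<^bsub>?Q\<^esub> k" "y = (K #> h) [^]\<^bsub>?Q\<^esub> l"
      using pow by blast
    then show "x \<otimes>\<^bsub>?Q\<^esub> y = y \<otimes>\<^bsub>?Q\<^esub> x"
      by (simp add: q.H.int_pow_mult[OF fh, symmetric] add.commute del: mult_FactGroup)
  qed
  then have "derived ?Q (carrier ?Q) = {\<one>\<^bsub>?Q\<^esub>}"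
    by (rule comm_group.derived_eq_singleton) simp
  then have "(#>) K ` derived G (carrier G) = {K}"
    using q.derived_img[of "carrier G"] by (simp add: carrier_FactGroup)
  then have "K #> g = K" if "g \<in> derived G (carrier G)" for g
    using that by (metis imageI singletonD)
  then have "derived G (carrier G) \<subseteq> K"
    using rcoset_eq_self_iff[OF K.subgroup_axioms] derived_in_carrier[OF subset_refl]
    by (simp add: subset_iff)
  from solvable_seq_derived_le[OF subgroup_self abelian_solvable_seq[OF K.subgroup_axioms ab] this]
  show ?thesis by (simp add: solvable_def)
qed

end

context exchange_group
begin

lemma solvable_if_rank_le_one:
  assumes "d \<le> 1"
  shows "solvable G"
proof -
  obtain X where X: "basis X" using basis_exists by blast
  then obtain h where h: "h \<in> carrier G" "X \<subseteq> {h}"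
    using assms basis_card[OF X] basis_carrier[OF X] basis_finite[OF X]
    by (cases "d = 0") (auto simp: card_1_singleton_iff le_Suc_eq)
  have "generate G (insert h {\<one>}) = carrier G"
  proof
    show "carrier G \<subseteq> generate G (insert h {\<one>})"
      using mono_generate[of X "insert h {\<one>}"] h X by (auto simp: basis_def)
  qed (use h generate_incl[of "insert h {\<one>}"] in auto)
  then show ?thesis
    by (intro solvable_cyclic_extension[OF one_is_normal _ h(1)]) auto
qed

text \<open>Take \<open>M\<close> of maximal order among the solvable normal subgroups of
  \<open>G\<close> inside the loops. If \<open>M\<close> were smaller than \<open>loops\<close>, the
  Frattini argument in \<open>G Mod M\<close> would yield an abelian \<open>Z\<close>; its preimage
  is a larger subgroup of the same kind.\<close>

lemma loops_solvable: "solvable_seq G loops"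
proof -
  define S where "S = {M. M \<lhd> G \<and> M \<subseteq> loops \<and> solvable_seq G M}"
  have "S \<subseteq> Pow (carrier G)" using loops_carrier by (auto simp: S_def)
  then have fS: "finite (card ` S)" using finite_carrier finite_subset by blast
  have "{\<one>} \<in> S"
    using one_is_normal solvable_seq.unity[of G] subgroup.one_closed[OF loops_subgroup]
    by (auto simp: S_def)
  then have "Max (card ` S) \<in> card ` S" using Max_in[OF fS] by blast
  then obtain M where Max_eq: "Max (card ` S) = card M" and "M \<in> S" by (rule imageE)
  have Mmax: "card M' \<le> card M" if "M' \<in> S" for M'
    using Max_ge[OF fS imageI[OF that]] Max_eq by simp
  from \<open>M \<in> S\<close>  have M: "M \<lhd> G" "M \<subseteq> loops" "solvable_seq G M" by (auto simp: S_def)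
  interpret M: normal M G by (rule M)
  interpret q: group_hom G "G Mod M" "(#>) M" by (rule group_hom_rcoset[OF M(1)])
  let ?Q = "G Mod M"
  have "M = loops"
  proof (rule ccontr)
    assume neq: "M \<noteq> loops"
    then obtain b where b: "b \<in> loops" "b \<notin> M" using M by blast
    have fQ: "finite (carrier ?Q)" using finite_carrier by (simp add: carrier_FactGroup)
    have L: "(#>) M ` loops \<lhd> ?Q"
    proof (rule q.H.normal_invI)
      show "subgroup ((#>) M ` loops) ?Q" by (rule q.subgroup_img_is_subgroup[OF loops_subgroup])
      fix x h assume "x \<in> carrier ?Q" "h \<in> (#>) M ` loops"
      then obtain g a where g: "g \<in> carrier G" "x = M #> g" and a: "a \<in> loops" "h = M #> a"
        by (auto simp: carrier_FactGroup)
      have ac: "a \<in> carrier G" using a loops_carrier by blast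
      have "x \<otimes>\<^bsub>?Q\<^esub> h \<otimes>\<^bsub>?Q\<^esub> inv\<^bsub>?Q\<^esub> x = M #> conjg G g a"
        unfolding g a using g ac by (simp del: mult_FactGroup)
      moreover have "conjg G g a \<in> loops" using normal.inv_op_closed2[OF loops_normal g(1) a(1)] .
      ultimately show "x \<otimes>\<^bsub>?Q\<^esub> h \<otimes>\<^bsub>?Q\<^esub> inv\<^bsub>?Q\<^esub> x \<in> (#>) M ` loops" by blast
    qed
    have Lnt: "(#>) M ` loops \<noteq> {\<one>\<^bsub>?Q\<^esub>}"
      using b rcoset_eq_self_iff[OF M.subgroup_axioms] loops_carrier by auto
    obtain Z where Z: "subgroup Z ?Q" "Z \<subseteq> (#>) M ` loops" "Z \<noteq> {\<one>\<^bsub>?Q\<^esub>}"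
      and Zab: "\<And>x y. x \<in> Z \<Longrightarrow> y \<in> Z \<Longrightarrow> x \<otimes>\<^bsub>?Q\<^esub> y = y \<otimes>\<^bsub>?Q\<^esub> x"
      and Zn: "\<And>g. g \<in> carrier ?Q \<Longrightarrow> \<exists>a\<in>(#>) M ` loops. \<forall>z\<in>Z. conjg ?Q (a \<otimes>\<^bsub>?Q\<^esub> g) z \<in> Z"
      using q.H.frattini_abelian[OF fQ L Lnt] by metis
    define M' where "M' = {g \<in> carrier G. M #> g \<in> Z}"
    have M'c: "M' \<subseteq> carrier G" by (auto simp: M'_def)
    have sub: "subgroup M' G"
    proof (rule finite_submonoid_is_subgroup[OF M'c])
      show "finite M'" using M'c finite_carrier finite_subset by blast
      show "\<one> \<in> M'" using subgroup.one_closed[OF Z(1)] M.subset by (simp add: M'_def)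
      fix x y assume "x \<in> M'" "y \<in> M'"
      then show "x \<otimes> y \<in> M'"
        using subgroup.m_closed[OF Z(1), of "M #> x" "M #> y"] by (simp add: M'_def del: mult_FactGroup)
    qed
    have MM': "M \<subseteq> M'"
      using subgroup.one_closed[OF Z(1)] M.rcos_const M.subset by (auto simp: M'_def)
    have "M \<noteq> M'"
    proof
      assume eq: "M = M'"
      obtain z where z: "z \<in> Z" "z \<noteq> M" using Z(3) subgroup.one_closed[OF Z(1)] by auto
      then obtain a where a: "a \<in> loops" "z = M #> a" using Z(2) by blast
      then have "a \<in> M'" using z loops_carrier by (auto simp: M'_def)
      then show False using z a eq M.rcos_const by blast
    qed
    then have less: "card M < card M'"
      using MM' M'c finite_carrier by (meson finite_subset psubsetI psubset_card_mono)
    have M'L: "M' \<subseteq> loops"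
    proof
      fix g assume g: "g \<in> M'"
      then obtain a where a: "a \<in> loops" "M #> a = M #> g" using Z(2) by (auto simp: M'_def)
      then obtain n where "n \<in> M" "g = n \<otimes> a"
        using rcoset_eqD[OF M.subgroup_axioms, of a g] g loops_carrier M'c by blast
      then show "g \<in> loops" using a M(2) subgroup.m_closed[OF loops_subgroup] by blast
    qed
    have "derived_set G M' \<subseteq> M"
    proof clarify
      fix x y assume xy: "x \<in> M'" "y \<in> M'"
      then have c: "x \<in> carrier G" "y \<in> carrier G" using M'c by auto
      have "M #> (x \<otimes> y) = M #> (y \<otimes> x)"
        using Zab[of "M #> x" "M #> y"] xy c by (simp add: M'_def del: mult_FactGroup)
      then obtain n where "n \<in> M" "x \<otimes> y = n \<otimes> (y \<otimes> x)"
        using rcoset_eqD[OF M.subgroup_axioms, of "y \<otimes> x" "x \<otimes> y"] c by auto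
      then show "x \<otimes> y \<otimes> inv x \<otimes> inv y \<in> M" using c M.subset by (auto simp: m_assoc subset_iff)
    qed
    then have "derived G M' \<subseteq> M"
      unfolding derived_def using generate_subgroup_incl[OF _ M.subgroup_axioms] by blast
    then have sol: "solvable_seq G M'" using solvable_seq_derived_le[OF sub M(3)] by blast
    \<comment> \<open>\<open>?H\<close> is the normalizer of \<open>M'\<close>. The Frattini
      argument shows that it meets every coset of the loops, and non-generation makes it the whole
      group.\<close>
    let ?H = "{h \<in> carrier G. \<forall>m\<in>M'. conjg G h m \<in> M'}"
    have "?H = carrier G"
    proof (rule loops_nongenerating)
      show "subgroup ?H G"
      proof (rule finite_submonoid_is_subgroup)
        show "finite ?H" using finite_carrier by simp
        show "\<one> \<in> ?H" using M'c by auto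
        fix x y assume "x \<in> ?H" "y \<in> ?H"
        then show "x \<otimes> y \<in> ?H" using M'c conjg_conjg[of x y] by auto
      qed auto
      fix g assume g: "g \<in> carrier G"
      then have "M #> g \<in> carrier ?Q" by simp
      from Zn[OF this] obtain a where a: "a \<in> loops"
        "\<And>z. z \<in> Z \<Longrightarrow> conjg ?Q ((M #> a) \<otimes>\<^bsub>?Q\<^esub> (M #> g)) z \<in> Z" by blast
      have ac: "a \<in> carrier G" using a loops_carrier by blast
      have "conjg G (a \<otimes> g) m \<in> M'" if m: "m \<in> M'" for m
      proof -
        have mc: "m \<in> carrier G" using m M'c by blast
        have "conjg ?Q ((M #> a) \<otimes>\<^bsub>?Q\<^esub> (M #> g)) (M #> m) = M #> conjg G (a \<otimes> g) m"
          using ac g mc by (simp del: mult_FactGroup)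
        then show ?thesis using a(2)[of "M #> m"] m ac g mc by (simp add: M'_def del: mult_FactGroup)
      qed
      then show "\<exists>a\<in>loops. a \<otimes> g \<in> ?H" using a g ac by auto
    qed
    then have "M' \<lhd> G" by (intro normal_invI[OF sub]) blast
    then have "card M' \<le> card M" using Mmax sol M'L by (simp add: S_def)
    then show False using less by simp
  qed
  then show ?thesis using M by simp
qed

text \<open>If the images of \<open>S\<close> generate the quotient, the subgroup generated by
  \<open>S\<close> meets every coset of the loops and is everything by
  \<open>loops_nongenerating\<close>.\<close>

lemma quotient_generate_iff:
  assumes S: "S \<subseteq> carrier G"
  shows "generate (G Mod loops) ((#>) loops ` S) = carrier (G Mod loops)
    \<longleftrightarrow> generate G S = carrier G"
proof
  interpret q: group_hom G "G Mod loops" "(#>) loops" by (rule group_hom_rcoset[OF loops_normal])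
  show "generate (G Mod loops) ((#>) loops ` S) = carrier (G Mod loops)" if "generate G S = carrier G"
    using q.generate_img[OF S] that by (simp add: carrier_FactGroup)
  assume gen: "generate (G Mod loops) ((#>) loops ` S) = carrier (G Mod loops)"
  show "generate G S = carrier G"
  proof (rule loops_nongenerating[OF generate_is_subgroup[OF S]])
    fix g assume g: "g \<in> carrier G"
    then have "loops #> g \<in> (#>) loops ` generate G S"
      using gen q.generate_img[OF S] by (simp add: carrier_FactGroup)
    then obtain h where h: "h \<in> generate G S" "loops #> g = loops #> h" by blast
    then obtain n where "n \<in> loops" "h = n \<otimes> g"
      using rcoset_eqD[OF loops_subgroup g] generate_incl[OF S] by blast
    then show "\<exists>a\<in>loops. a \<otimes> g \<in> generate G S" using h by blast
  qed
qed

text \<open>Choosing coset representatives \<open>r\<close> lifts generating sets of the quotient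
  without changing their size. This keeps the minimum at \<open>d\<close>, and exchanges found in
  \<open>G\<close> project to the quotient.\<close>

lemma quotient_exchange_group: "exchange_group (G Mod loops) d"
proof -
  interpret q: group_hom G "G Mod loops" "(#>) loops" by (rule group_hom_rcoset[OF loops_normal])
  let ?Q = "G Mod loops" and ?f = "(#>) loops"
  have "\<exists>g. g \<in> carrier G \<and> ?f g = C" if "C \<in> carrier ?Q" for C
    using that by (auto simp: carrier_FactGroup)
  then obtain r where r: "\<And>C. C \<in> carrier ?Q \<Longrightarrow> r C \<in> carrier G \<and> ?f (r C) = C" by metis
  have fr: "?f ` r ` S = S" if "S \<subseteq> carrier ?Q" for S
    using that r by (simp add: image_image subset_iff cong: image_cong_simp)
  have fin: "finite (carrier ?Q)" using finite_carrier by (simp add: carrier_FactGroup)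
  have rgen: "r ` S \<subseteq> carrier G" "generate G (r ` S) = carrier G"
    if "S \<subseteq> carrier ?Q" "generate ?Q S = carrier ?Q" for S
  proof -
    show *: "r ` S \<subseteq> carrier G" using that(1) r by blast
    show "generate G (r ` S) = carrier G"
      using quotient_generate_iff[OF *] fr[OF that(1)] that(2) by simp
  qed
  have min: "d \<le> card S" if "S \<subseteq> carrier ?Q" "generate ?Q S = carrier ?Q" for S
    using d_minimal[OF rgen[OF that]] card_image_le[of S r] finite_subset[OF that(1) fin] by linarith
  show ?thesis
  proof
    show "finite (carrier ?Q)" by (rule fin)
    show "\<And>S. S \<subseteq> carrier ?Q \<Longrightarrow> generate ?Q S = carrier ?Q \<Longrightarrow> d \<le> card S" by (rule min)
    obtain X where X: "basis X" using basis_exists by blast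
    have "?f ` X \<subseteq> carrier ?Q" using basis_carrier[OF X] by auto
    moreover have "generate ?Q (?f ` X) = carrier ?Q"
      using quotient_generate_iff X by (simp add: basis_def)
    moreover have "card (?f ` X) = d"
      using min[OF calculation] card_image_le[OF basis_finite[OF X], of ?f] basis_card[OF X] by simp
    ultimately show "\<exists>S\<subseteq>carrier ?Q. card S = d \<and> generate ?Q S = carrier ?Q" by blast
  next
    fix X Y x
    assume X: "X \<subseteq> carrier ?Q" "card X = d" "generate ?Q X = carrier ?Q"
      and Y: "Y \<subseteq> carrier ?Q" "card Y = d" "generate ?Q Y = carrier ?Q" and x: "x \<in> X"
    have inj: "inj_on r S" if "S \<subseteq> carrier ?Q" for S
      using that r by (metis inj_on_def subsetD)
    have cards: "card (r ` X) = d" "card (r ` Y) = d"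
      using inj X Y by (simp_all add: card_image)
    obtain y where y: "y \<in> Y" "generate G (insert (r y) (r ` X - {r x})) = carrier G"
      using exchange_ax[OF rgen(1)[OF X(1,3)] cards(1) rgen(2)[OF X(1,3)]
          rgen(1)[OF Y(1,3)] cards(2) rgen(2)[OF Y(1,3)] imageI[OF x]] by blast
    have eq: "insert (r y) (r ` X - {r x}) = r ` insert y (X - {x})"
      using inj[OF X(1)] x by (auto simp: inj_on_def)
    have sub: "insert y (X - {x}) \<subseteq> carrier ?Q" using X Y y by blast
    have "generate ?Q (?f ` r ` insert y (X - {x})) = carrier ?Q"
      by (subst quotient_generate_iff) (use sub r y(2) eq in auto)
    then show "\<exists>y\<in>Y. generate ?Q (insert y (X - {x})) = carrier ?Q"
      using y(1) fr[OF sub] by auto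
  qed
qed

lemma quotient_loops: "exchange_group.loops (G Mod loops) d = {\<one>\<^bsub>G Mod loops\<^esub>}"
proof
  interpret q: group_hom G "G Mod loops" "(#>) loops" by (rule group_hom_rcoset[OF loops_normal])
  let ?Q = "G Mod loops" and ?f = "(#>) loops"
  interpret Q: exchange_group ?Q d by (rule quotient_exchange_group)
  show "{\<one>\<^bsub>?Q\<^esub>} \<subseteq> Q.loops" using subgroup.one_closed[OF Q.loops_subgroup] by auto
  show "Q.loops \<subseteq> {\<one>\<^bsub>?Q\<^esub>}"
  proof
    fix C assume C: "C \<in> Q.loops"
    then obtain a where a: "a \<in> carrier G" "C = ?f a"
      using Q.loops_carrier by (auto simp: carrier_FactGroup)
    have "basis (insert (a \<otimes> x) (X - {x}))" if X: "basis X" "x \<in> X" for X x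
    proof (rule gen_basis)
      have Xc: "X \<subseteq> carrier G" using basis_carrier X by blast
      show sub: "insert (a \<otimes> x) (X - {x}) \<subseteq> carrier G" using Xc a X by auto
      show "card (insert (a \<otimes> x) (X - {x})) \<le> d"
        using card_insert_Diff_le[OF basis_finite[OF X(1)] X(2)] basis_card[OF X(1)] by simp
      have gX: "generate ?Q (?f ` X) = carrier ?Q"
        using quotient_generate_iff[OF Xc] X by (simp add: basis_def)
      have "?f ` X \<subseteq> carrier ?Q" using Xc by auto
      moreover have "card (?f ` X) \<le> d"
        using card_image_le[OF basis_finite[OF X(1)]] basis_card[OF X(1)] by metis
      ultimately have bX: "Q.basis (?f ` X)" by (rule Q.gen_basis[OF _ gX])
      \<comment> \<open>The image of \<open>X\<close> is again a basis and has \<open>d\<close>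
        elements, so no two elements of \<open>X\<close> share a coset.\<close>
      have inj: "inj_on ?f X"
        using Q.basis_card[OF bX] basis_card[OF X(1)] basis_finite[OF X(1)]
        by (simp add: eq_card_imp_inj_on)
      have "Q.basis (insert (?f a \<otimes>\<^bsub>?Q\<^esub> ?f x) (?f ` X - {?f x}))"
        using Q.loopsD[OF _ bX, of C "?f x"] C a X by simp
      moreover have "insert (?f a \<otimes>\<^bsub>?Q\<^esub> ?f x) (?f ` X - {?f x}) = ?f ` insert (a \<otimes> x) (X - {x})"
        using inj X a Xc by (auto simp: inj_on_def subset_iff simp del: mult_FactGroup)
      ultimately have "generate ?Q (?f ` insert (a \<otimes> x) (X - {x})) = carrier ?Q"
        by (simp add: Q.basis_def)
      then show "generate G (insert (a \<otimes> x) (X - {x})) = carrier G"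
        using quotient_generate_iff[OF sub] by simp
    qed
    then have "a \<in> loops" using a by (simp add: loops_def)
    then show "C \<in> {\<one>\<^bsub>?Q\<^esub>}" using a rcoset_eq_self_iff[OF loops_subgroup] by simp
  qed
qed

end

section \<open>The loopless case\<close>

locale loopless_exchange_group = exchange_group +
  assumes loops_trivial: "loops = {\<one>}"
    and rank_ge_two: "2 \<le> d"
begin

text \<open>Since \<one> lies in no basis, it is parallel to everything. Transitivity therefore
  needs a nontrivial middle element.\<close>

definition parallel :: "'a \<Rightarrow> 'a \<Rightarrow> bool" where
  "parallel x y \<longleftrightarrow> x = y \<or> \<not> indep {x, y}"

definition point :: "'a \<Rightarrow> 'a set" where
  "point x = {w \<in> carrier G. w = \<one> \<or> parallel w x}"

text \<open>Conjugation permutes the points, so this is the normalizer of \<open>point x\<close>.\<close>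

definition nrm :: "'a \<Rightarrow> 'a set" where
  "nrm x = {g \<in> carrier G. parallel (conjg G g x) x}"

text \<open>The union of the normal points, with \<one> added; closure under multiplication is not
  part of the definition.\<close>

definition normal_part :: "'a set" where
  "normal_part = {y \<in> carrier G. y = \<one> \<or> nrm y = carrier G}"

definition point_conjugates :: "'a \<Rightarrow> 'a set" where
  "point_conjugates x = {conjg G g y | g y. g \<in> carrier G \<and> y \<in> point x - {\<one>}}"

section \<open>Points and their normalizers\<close>

lemma indep_nontrivial: "x \<in> carrier G \<Longrightarrow> x \<noteq> \<one> \<Longrightarrow> indep {x}"
  using indep_or_loop[OF rank_ge_two, of x] loops_trivial by auto

lemma par_refl [simp]: "parallel x x"
  by (simp add: parallel_def)

lemma par_sym: "parallel x y \<Longrightarrow> parallel y x"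
  by (auto simp: parallel_def insert_commute)

lemma par_subst:
  assumes "basis X" "y \<in> X" "parallel w y" "w \<in> carrier G" "w \<noteq> \<one>"
  shows "basis (insert w (X - {y}))"
  using parallel_subst[OF assms(1,2) indep_nontrivial] assms by (simp add: parallel_def)

lemma not_par_in_basis:
  assumes "\<not> parallel x y"
  obtains X where "basis X" "x \<in> X" "y \<in> X" "x \<noteq> y"
  using assms by (auto simp: parallel_def indep_def)

lemma basis_not_par: "basis X \<Longrightarrow> x \<in> X \<Longrightarrow> y \<in> X \<Longrightarrow> x \<noteq> y \<Longrightarrow> \<not> parallel x y"
  by (auto simp: parallel_def indep_def)

lemma basis_nontrivial: "basis X \<Longrightarrow> x \<in> X \<Longrightarrow> x \<in> carrier G \<and> x \<noteq> \<one>"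
  using one_not_in_basis basis_carrier by blast

text \<open>If \<open>u\<close> and \<open>v\<close> lay in a common basis, \<open>v\<close> could
  be replaced in it by the parallel \<open>x\<close>, giving a common basis of \<open>u\<close> and
  \<open>x\<close>.\<close>

lemma par_trans:
  assumes x: "x \<in> carrier G" "x \<noteq> \<one>" and "parallel u x" "parallel x v"
  shows "parallel u v"
proof (rule ccontr)
  assume "\<not> parallel u v"
  then obtain X where X: "basis X" "u \<in> X" "v \<in> X" "u \<noteq> v" by (rule not_par_in_basis)
  have b: "basis (insert x (X - {v}))" using par_subst[OF X(1,3)] assms by blast
  have "x \<noteq> u" using basis_insert_notin[OF X(1,3) b] X by blast
  then show False using basis_not_par[OF b, of u x] assms X by blast
qed

lemma par_conjg:
  assumes g: "g \<in> carrier G" and c: "x \<in> carrier G" "y \<in> carrier G"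
  shows "parallel (conjg G g x) (conjg G g y) \<longleftrightarrow> parallel x y"
proof -
  have *: "indep {conjg G h u, conjg G h v}" if h: "h \<in> carrier G" and i: "indep {u, v}" for h u v
  proof -
    obtain X where X: "basis X" "{u, v} \<subseteq> X" using i by (rule indepE)
    show ?thesis by (rule basis_indep[OF basis_conjg[OF X(1) h]]) (use X in auto)
  qed
  have "indep {conjg G g x, conjg G g y} \<longleftrightarrow> indep {x, y}"
    using *[of g x y] *[of "inv g" "conjg G g x" "conjg G g y"] g c conjg_inv_cancel(1)[OF g]
    by (auto simp del: inv_inv)
  then show ?thesis unfolding parallel_def using g c by simp
qed

lemma conjg_nontrivial:
  "g \<in> carrier G \<Longrightarrow> x \<in> carrier G \<and> x \<noteq> \<one> \<Longrightarrow> conjg G g x \<in> carrier G \<and> conjg G g x \<noteq> \<one>"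
  using conjg_eq_one_iff by auto

text \<open>If \<open>u \<otimes> v\<close> were not parallel to \<open>u\<close>, the two would lie
  in a common basis, where \<open>u \<otimes> v\<close> may be replaced by \<open>v\<close>; then
  \<open>u\<close> and \<open>v\<close> would not be parallel.\<close>

lemma point_subgroup:
  assumes x: "x \<in> carrier G" "x \<noteq> \<one>"
  shows "subgroup (point x) G"
proof (rule finite_submonoid_is_subgroup)
  show "point x \<subseteq> carrier G" by (auto simp: point_def)
  then show "finite (point x)" using finite_carrier finite_subset by blast
  show "\<one> \<in> point x" by (simp add: point_def)
  fix u v assume u: "u \<in> point x" and v: "v \<in> point x"
  then have c: "u \<in> carrier G" "v \<in> carrier G" by (auto simp: point_def)
  show "u \<otimes> v \<in> point x"
  proof (cases "u = \<one> \<or> v = \<one> \<or> u \<otimes> v = \<one>")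
    case True
    then show ?thesis using u v c by (auto simp: point_def)
  next
    case False
    then have ux: "parallel u x" and vx: "parallel v x" using u v by (auto simp: point_def)
    then have uv: "parallel v u" using par_trans[OF x vx par_sym[OF ux]] by simp
    have "parallel (u \<otimes> v) u"
    proof (rule ccontr)
      assume "\<not> parallel (u \<otimes> v) u"
      then obtain X where X: "basis X" "u \<otimes> v \<in> X" "u \<in> X" "u \<otimes> v \<noteq> u" by (rule not_par_in_basis)
      let ?S = "insert v (X - {u \<otimes> v})"
      have "u \<otimes> v \<in> generate G ?S"
        by (rule generate.eng) (use X in \<open>auto intro!: generate.incl\<close>)
      then have b: "basis ?S" using X c by (intro basis_subst)
      have u: "u \<in> X - {u \<otimes> v}" using X(3,4) by simp
      then have "v \<noteq> u" using basis_insert_notin[OF X(1,2) b] by blast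
      then show False using basis_not_par[OF b insertI1 insertI2[OF u]] uv by blast
    qed
    then show ?thesis using par_trans[of u "u \<otimes> v" x] ux False c by (simp add: point_def)
  qed
qed

lemma point_self: "x \<in> carrier G \<Longrightarrow> x \<in> point x"
  by (simp add: point_def)

lemma point_nontrivialD: "y \<in> point x - {\<one>} \<Longrightarrow> y \<in> carrier G \<and> y \<noteq> \<one> \<and> parallel y x"
  by (auto simp: point_def)

lemma nrm_cong:
  assumes x: "x \<in> carrier G" "x \<noteq> \<one>" and y: "y \<in> carrier G" "y \<noteq> \<one>" and p: "parallel y x"
  shows "nrm y = nrm x"
proof -
  have *: "parallel (conjg G g u) u"
    if "parallel (conjg G g v) v" "parallel u v" "g \<in> carrier G" "u \<in> carrier G" "v \<in> carrier G" "v \<noteq> \<one>" for g u v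
    using par_trans[of "conjg G g v" "conjg G g u" v] par_trans[of v "conjg G g u" u]
      par_conjg[of g u v] conjg_nontrivial[of g v] par_sym[of u v] that by blast
  show ?thesis unfolding nrm_def using * assms par_sym[OF p] by blast
qed

lemma conjg_in_point: "g \<in> nrm x \<Longrightarrow> x \<in> carrier G \<Longrightarrow> conjg G g x \<in> point x"
  by (simp add: nrm_def point_def)

lemma nrm_subgroup:
  assumes x: "x \<in> carrier G" "x \<noteq> \<one>"
  shows "subgroup (nrm x) G"
proof (rule finite_submonoid_is_subgroup)
  show "nrm x \<subseteq> carrier G" by (auto simp: nrm_def)
  then show "finite (nrm x)" using finite_carrier finite_subset by blast
  show "\<one> \<in> nrm x" using x by (simp add: nrm_def)
  fix g h assume "g \<in> nrm x" "h \<in> nrm x"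
  then have gh: "g \<in> carrier G" "h \<in> carrier G" "parallel (conjg G g x) x" "parallel (conjg G h x) x"
    by (auto simp: nrm_def)
  have "parallel (conjg G g (conjg G h x)) (conjg G g x)" using par_conjg gh x by simp
  then have "parallel (conjg G g (conjg G h x)) x"
    using par_trans[of "conjg G g x"] gh conjg_nontrivial[of g x] x by blast
  then show "g \<otimes> h \<in> nrm x" using gh x conjg_conjg by (simp add: nrm_def)
qed

lemma point_subset_nrm:
  assumes x: "x \<in> carrier G" "x \<noteq> \<one>"
  shows "point x \<subseteq> nrm x"
proof
  fix g assume g: "g \<in> point x"
  then have gc: "g \<in> carrier G" by (auto simp: point_def)
  have "conjg G g x \<in> point x"
    using subgroup_conjg_closed[OF point_subgroup[OF x] g point_self] x by blast
  then show "g \<in> nrm x" using conjg_nontrivial[OF gc] x gc by (auto simp: nrm_def point_def)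
qed

lemma nrm_conjg:
  assumes x: "x \<in> carrier G" and g: "g \<in> carrier G" and n: "nrm (conjg G g x) = carrier G"
  shows "nrm x = carrier G"
proof -
  have "parallel (conjg G h x) x" if h: "h \<in> carrier G" for h
  proof -
    have "conjg G g h \<in> nrm (conjg G g x)" using n g h by simp
    then have "parallel (conjg G (conjg G g h) (conjg G g x)) (conjg G g x)" by (simp add: nrm_def)
    moreover have "conjg G (conjg G g h) (conjg G g x) = conjg G g (conjg G h x)"
      using x g h by (simp add: m_assoc inv_mult_group)
    ultimately show ?thesis using par_conjg[OF g, of "conjg G h x" x] x h by simp
  qed
  then show ?thesis by (auto simp: nrm_def)
qed

text \<open>Extend the pair consisting of \<open>x\<close> and its conjugate from \<open>X\<close>.
  If \<open>g\<close> survived, the conjugate would be redundant, being a word in \<open>g\<close>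
  and \<open>x\<close>. So \<open>g\<close> is the element that is dropped.\<close>

lemma conjg_subst:
  assumes X: "basis X" "x \<in> X" "g \<in> X" and np: "\<not> parallel (conjg G g x) x"
  shows "basis (insert (conjg G g x) (X - {g}))"
proof -
  let ?y = "conjg G g x"
  have c: "x \<in> carrier G" "g \<in> carrier G" using X basis_carrier by blast+
  have "indep {?y, x}" "?y \<noteq> x" using np by (auto simp: parallel_def)
  from \<open>indep {?y, x}\<close> obtain Z where Z: "basis Z" "{?y, x} \<subseteq> Z" "Z \<subseteq> {?y, x} \<union> X"
    using augment[OF _ X(1)] by metis
  have "?y \<noteq> g"
  proof
    assume "?y = g"
    moreover have "conjg G g g = g" using c by (simp add: m_assoc)
    ultimately have "x = g" using c by (metis conjg_inj)
    then show False using \<open>?y \<noteq> x\<close> \<open>?y = g\<close> by simp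
  qed
  have "g \<notin> Z"
  proof
    assume g: "g \<in> Z"
    have "Z - {?y} \<subseteq> carrier G" using basis_carrier[OF Z(1)] by blast
    then have "?y \<in> generate G (Z - {?y})"
      by (rule generate_closed(3)) (use g Z \<open>?y \<noteq> g\<close> \<open>?y \<noteq> x\<close> in \<open>auto intro!: generate.incl\<close>)
    then show False using basis_redundant[OF Z(1)] Z by blast
  qed
  then have "Z \<subseteq> insert ?y (X - {g})" using Z X by blast
  then have "Z = insert ?y (X - {g})"
    using card_insert_Diff_le[OF basis_finite[OF X(1)] X(3), of ?y] basis_card[OF X(1)]
      basis_card[OF Z(1)] basis_finite[OF X(1)]
    by (intro card_seteq) auto
  then show ?thesis using Z by simp
qed

text \<open>If \<open>n\<close> normalizes \<open>point x\<close> and \<open>m\<close> does not, then \<open>m\<close> and \<open>m \<otimes> n\<close> conjugate \<open>x\<close> into the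
  same point. For \<open>n \<notin> point x\<close> this is impossible, as \<open>x\<close>, \<open>m\<close> and \<open>m \<otimes> n\<close> lie in a common
  basis.\<close>

lemma nrm_dichotomy:
  assumes x: "x \<in> carrier G" "x \<noteq> \<one>" and nn: "nrm x \<noteq> carrier G"
  shows "nrm x = point x"
proof (rule ccontr)
  assume "nrm x \<noteq> point x"
  then obtain n where n: "n \<in> nrm x" "n \<notin> point x" using point_subset_nrm[OF x] by blast
  then have nc: "n \<in> carrier G" and npar: "\<not> parallel n x" and nx: "parallel (conjg G n x) x"
    by (auto simp: nrm_def point_def)
  obtain X where X: "basis X" "n \<in> X" "x \<in> X" "n \<noteq> x" using not_par_in_basis[OF npar] .
  have "\<not> X \<subseteq> nrm x"
  proof
    assume "X \<subseteq> nrm x"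
    from generate_subgroup_incl[OF this nrm_subgroup[OF x]] have "carrier G \<subseteq> nrm x"
      using X by (simp add: basis_def)
    then show False using nn by (auto simp: nrm_def)
  qed
  then obtain m where m: "m \<in> X" "m \<notin> nrm x" by blast
  have mc: "m \<in> carrier G" using m basis_carrier X by blast
  have mx: "\<not> parallel (conjg G m x) x" using m mc by (simp add: nrm_def)
  have mn: "m \<noteq> n" "m \<noteq> x" using m n point_subset_nrm[OF x] point_self x by auto
  \<comment> \<open>The moves are n to \<open>m \<otimes> n\<close>, and \<open>m\<close> to
    \<open>conjg G m x\<close>; after both, \<open>x\<close> and \<open>m \<otimes> n\<close> are
    still in the basis.\<close>
  define X1 where "X1 = insert (m \<otimes> n) (X - {n})"
  have X1: "basis X1" unfolding X1_def by (rule basis_mult_left) (use X m mn in auto)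
  have mnX: "m \<otimes> n \<notin> X - {n}" using basis_insert_notin[OF X(1,2)] X1 by (simp add: X1_def)
  define X2 where "X2 = insert (conjg G m x) (X1 - {m})"
  have X2: "basis X2" unfolding X2_def
    by (rule conjg_subst[OF X1 _ _ mx]) (use X m mn in \<open>auto simp: X1_def\<close>)
  have X2n: "conjg G m x \<notin> X1 - {m}"
    by (rule basis_insert_notin[OF X1]) (use X2 m mn in \<open>auto simp: X1_def X2_def\<close>)
  let ?y = "conjg G (m \<otimes> n) x"
  have yc: "?y \<in> carrier G" "?y \<noteq> \<one>" using conjg_nontrivial[of "m \<otimes> n" x] mc nc x by simp_all
  \<comment> \<open>As \<open>n\<close> normalizes the point of \<open>x\<close>, the conjugates of
    \<open>x\<close> by \<open>m \<otimes> n\<close> and by \<open>m\<close> are parallel, so the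
    former may take the place of the latter. There it is redundant, being a word in \<open>x\<close>
    and \<open>m \<otimes> n\<close>.\<close>
  have "parallel ?y (conjg G m x)" using par_conjg[of m "conjg G n x" x] conjg_conjg nx mc nc x by simp
  then have X3: "basis (insert ?y (X2 - {conjg G m x}))"
    by (intro par_subst[OF X2 _ _ yc]) (simp add: X2_def)
  have eq: "X2 - {conjg G m x} = X1 - {m}" using X2n by (auto simp: X2_def)
  have "conjg G m x \<in> X2" by (simp add: X2_def)
  from basis_insert_notin[OF X2 this X3] have notin: "?y \<notin> X1 - {m}" unfolding eq .
  have sub: "X1 - {m} \<subseteq> carrier G" using basis_carrier[OF X1] by blast
  have "x \<in> X1 - {m}" using X mn by (auto simp: X1_def)
  moreover have "m \<otimes> n \<in> X1 - {m}" using mnX m mn by (auto simp: X1_def)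
  ultimately have "?y \<in> generate G (X1 - {m})"
    using generate_closed(3)[OF sub] by (blast intro: generate.incl)
  then show False
    using basis_redundant[OF X3, of ?y] eq notin by simp
qed

section \<open>Counting the conjugates of a nonnormal point\<close>

lemma card_point_conjugates:
  assumes x: "x \<in> carrier G" "x \<noteq> \<one>" and nn: "nrm x = point x"
  shows "card (point_conjugates x) * card (point x) = card (carrier G) * (card (point x) - 1)"
proof -
  let ?P = "point x"
  interpret P: subgroup ?P G by (rule point_subgroup[OF x])
  \<comment> \<open>Double counting of the pairs (g, y) with y a nontrivial element of the point,
    according to the value of the conjugate of y by g.\<close>
  define S where "S = carrier G \<times> (?P - {\<one>})"
  define f where "f = (\<lambda>(g, y). conjg G g y)"
  have finP: "finite ?P" using P.subset finite_carrier finite_subset by blast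
  have finS: "finite S" using finP finite_carrier by (simp add: S_def)
  have im: "f ` S = point_conjugates x" by (auto simp: f_def S_def point_conjugates_def)
  have fiber: "card {s \<in> S. f s = u} = card ?P" if u: "u \<in> f ` S" for u
  proof -
    obtain g0 y0 where g0: "g0 \<in> carrier G" and y0: "y0 \<in> ?P" "y0 \<noteq> \<one>" and u: "u = conjg G g0 y0"
      using u by (auto simp: S_def f_def)
    have y0c: "y0 \<in> carrier G" using y0 by simp
    \<comment> \<open>Two pairs with the same value differ by an element conjugating one nontrivial
      element of the point to another. Such an element normalizes the point and therefore lies in
      it.\<close>
    have "bij_betw (\<lambda>p. (g0 \<otimes> p, conjg G (inv p) y0)) ?P {s \<in> S. f s = u}"
      unfolding bij_betw_def
    proof
      show "inj_on (\<lambda>p. (g0 \<otimes> p, conjg G (inv p) y0)) ?P"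
        using g0 by (auto simp: inj_on_def)
      show "(\<lambda>p. (g0 \<otimes> p, conjg G (inv p) y0)) ` ?P = {s \<in> S. f s = u}"
      proof
        show "(\<lambda>p. (g0 \<otimes> p, conjg G (inv p) y0)) ` ?P \<subseteq> {s \<in> S. f s = u}"
        proof
          fix s assume "s \<in> (\<lambda>p. (g0 \<otimes> p, conjg G (inv p) y0)) ` ?P"
          then obtain p where p: "p \<in> ?P" "s = (g0 \<otimes> p, conjg G (inv p) y0)" by blast
          have pc: "p \<in> carrier G" using p by simp
          have "conjg G (inv p) y0 \<in> ?P"
            using subgroup_conjg_closed[OF P.subgroup_axioms] p y0 by blast
          moreover have "conjg G (inv p) y0 \<noteq> \<one>" using conjg_nontrivial[of "inv p" y0] pc y0 y0c by blast
          moreover have "conjg G (g0 \<otimes> p) (conjg G (inv p) y0) = u"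
            using conjg_conjg[of g0 p "conjg G (inv p) y0"] conjg_inv_cancel(2)[OF pc y0c] g0 pc y0c u
            by (simp del: inv_inv)
          ultimately show "s \<in> {s \<in> S. f s = u}" using p g0 by (simp add: S_def f_def)
        qed
        show "{s \<in> S. f s = u} \<subseteq> (\<lambda>p. (g0 \<otimes> p, conjg G (inv p) y0)) ` ?P"
        proof
          fix s assume "s \<in> {s \<in> S. f s = u}"
          then obtain g y where s: "s = (g, y)" and g: "g \<in> carrier G" and y: "y \<in> ?P" "y \<noteq> \<one>"
            and eq: "conjg G g y = conjg G g0 y0" by (auto simp: S_def f_def u)
          have yc: "y \<in> carrier G" using y by simp
          define p where "p = inv g0 \<otimes> g"
          have pc: "p \<in> carrier G" using g g0 by (simp add: p_def)
          have py: "conjg G p y = y0"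
            using conjg_conjg[of "inv g0" g y] eq conjg_inv_cancel(1)[OF g0 y0c] g g0 yc
            by (simp add: p_def)
          have "parallel y x" "parallel y0 x"
            using y y0 point_nontrivialD[of y x] point_nontrivialD[of y0 x] by blast+
          then have "parallel y0 y" using par_trans[OF x \<open>parallel y0 x\<close> par_sym[OF \<open>parallel y x\<close>]] by blast
          then have "p \<in> nrm y" using py pc by (simp add: nrm_def)
          then have "p \<in> ?P" using nrm_cong[OF x yc y(2) \<open>parallel y x\<close>] nn by simp
          moreover have "g0 \<otimes> p = g" using g g0 by (simp add: p_def)
          moreover have "conjg G (inv p) y0 = y" using conjg_inv_cancel(1)[OF pc yc] py by simp
          ultimately show "s \<in> (\<lambda>p. (g0 \<otimes> p, conjg G (inv p) y0)) ` ?P" using s by force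
        qed
      qed
    qed
    from bij_betw_same_card[OF this] show ?thesis by (rule sym)
  qed
  have "card S = (\<Sum>u\<in>f ` S. card {s \<in> S. f s = u})"
    unfolding card_eq_sum by (rule sum.image_gen[OF finS])
  also have "\<dots> = (\<Sum>u\<in>f ` S. card ?P)" by (intro sum.cong refl fiber)
  also have "\<dots> = card (point_conjugates x) * card ?P" by (simp add: im)
  finally have "card S = card (point_conjugates x) * card ?P" .
  moreover have "card (?P - {\<one>}) = card ?P - 1" using P.one_closed by (rule card_Diff_singleton)
  ultimately show ?thesis unfolding S_def card_cartesian_product by simp
qed

lemma point_conjugates_par:
  assumes x: "x \<in> carrier G" "x \<noteq> \<one>"
  shows "u \<in> point_conjugates x \<longleftrightarrow> u \<in> carrier G \<and> u \<noteq> \<one> \<and> (\<exists>g\<in>carrier G. parallel u (conjg G g x))"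
proof
  assume "u \<in> point_conjugates x"
  then obtain g y where g: "g \<in> carrier G" "y \<in> point x - {\<one>}" "u = conjg G g y"
    by (auto simp: point_conjugates_def)
  then show "u \<in> carrier G \<and> u \<noteq> \<one> \<and> (\<exists>g\<in>carrier G. parallel u (conjg G g x))"
  proof -
    have y: "y \<in> carrier G \<and> y \<noteq> \<one>" "parallel y x" using point_nontrivialD[OF g(2)] by blast+
    have "parallel u (conjg G g x)" unfolding g(3) using par_conjg[of g y x] g(1) x y by blast
    moreover have "u \<in> carrier G \<and> u \<noteq> \<one>" unfolding g(3) by (rule conjg_nontrivial[OF g(1) y(1)])
    ultimately show ?thesis using g(1) by blast
  qed
next
  assume "u \<in> carrier G \<and> u \<noteq> \<one> \<and> (\<exists>g\<in>carrier G. parallel u (conjg G g x))"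
  then obtain g where u: "u \<in> carrier G" "u \<noteq> \<one>" and g: "g \<in> carrier G" "parallel u (conjg G g x)" by blast
  define y where "y = conjg G (inv g) u"
  have uy: "u = conjg G g y" unfolding y_def using conjg_inv_cancel(2)[OF g(1) u(1)] by simp
  have y: "y \<in> carrier G" "y \<noteq> \<one>" unfolding y_def using conjg_nontrivial[of "inv g" u] g u by blast+
  have "parallel y x" using par_conjg[OF g(1) y(1) x(1)] g uy by simp
  then show "u \<in> point_conjugates x"
    unfolding point_conjugates_def using uy y g by (auto simp: point_def)
qed

text \<open>The conjugates cover the fraction 1 - 1/|P| with |P| the size of the point, and |P| is
  at least 2.\<close>

lemma point_conjugates_bound:
  assumes x: "x \<in> carrier G" "x \<noteq> \<one>" and nn: "nrm x \<noteq> carrier G"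
  shows "card (carrier G) \<le> 2 * card (point_conjugates x)"
proof -
  have eq: "card (point_conjugates x) * card (point x) = card (carrier G) * (card (point x) - 1)"
    using card_point_conjugates[OF x nrm_dichotomy[OF x nn]] .
  have "finite (point x)" using finite_carrier by (simp add: point_def)
  moreover have "{\<one>, x} \<subseteq> point x" using x by (auto simp: point_def)
  ultimately have "card {\<one>, x} \<le> card (point x)" by (rule card_mono)
  then obtain k where k: "card (point x) = k + 2"
    using x by (auto simp: le_iff_add add.commute split: if_splits)
  have "card (carrier G) * (k + 2) \<le> 2 * (card (carrier G) * (k + 1))"
    by (simp add: algebra_simps)
  also have "\<dots> = 2 * card (point_conjugates x) * (k + 2)" using eq k by simp
  finally show ?thesis using mult_le_cancel2 by (metis add_gr_0 zero_less_numeral)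
qed

text \<open>The conjugates of a nonnormal point cover at least half of the group.\<close>

lemma nonnormal_conjugate:
  assumes x: "x \<in> carrier G" "x \<noteq> \<one>" "nrm x \<noteq> carrier G"
    and y: "y \<in> carrier G" "y \<noteq> \<one>" "nrm y \<noteq> carrier G"
  shows "y \<in> point_conjugates x"
proof (rule ccontr)
  assume ny: "y \<notin> point_conjugates x"
  let ?U = "point_conjugates x" and ?W = "point_conjugates y"
  have "?U \<inter> ?W = {}"
  proof (rule ccontr)
    assume "?U \<inter> ?W \<noteq> {}"
    then obtain u where "u \<in> ?U" "u \<in> ?W" by blast
    then obtain g h where u: "u \<in> carrier G" "u \<noteq> \<one>" and g: "g \<in> carrier G" "parallel u (conjg G g x)"
      and h: "h \<in> carrier G" "parallel u (conjg G h y)"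
      unfolding point_conjugates_par[OF x(1,2)] point_conjugates_par[OF y(1,2)] by blast
    have "parallel (conjg G h y) (conjg G g x)" using par_trans[OF u par_sym[OF h(2)] g(2)] .
    moreover have "conjg G g x = conjg G h (conjg G (inv h \<otimes> g) x)"
      using conjg_conjg[of h "inv h \<otimes> g" x] g h x by simp
    ultimately have "parallel y (conjg G (inv h \<otimes> g) x)"
      using par_conjg[OF h(1) y(1), of "conjg G (inv h \<otimes> g) x"] g h x by simp
    then show False using ny point_conjugates_par[OF x(1,2)] y g h by auto
  qed
  moreover have sub: "?U \<subseteq> carrier G - {\<one>}" "?W \<subseteq> carrier G - {\<one>}"
    using point_conjugates_par x y by auto
  moreover have fin: "finite (carrier G - {\<one>})" using finite_carrier by simp
  ultimately have "card ?U + card ?W \<le> card (carrier G - {\<one>})"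
    using card_Un_disjoint[of ?U ?W] card_mono[OF fin, of "?U \<union> ?W"] finite_subset[OF _ fin] by simp
  moreover have "card (carrier G - {\<one>}) < card (carrier G)"
    using finite_carrier by (intro card_Diff1_less) auto
  \<comment> \<open>Two disjoint sets of at least half the group each would fill it, but both avoid
    \<one>.\<close>
  ultimately show False using point_conjugates_bound[OF x] point_conjugates_bound[OF y] by linarith
qed

lemma normal_part_complement:
  assumes x: "x \<in> carrier G" "x \<noteq> \<one>" "nrm x \<noteq> carrier G"
  shows "normal_part = carrier G - point_conjugates x"
proof
  show "carrier G - point_conjugates x \<subseteq> normal_part"
    using nonnormal_conjugate[OF x] by (auto simp: normal_part_def)
  show "normal_part \<subseteq> carrier G - point_conjugates x"
  proof
    fix u assume u: "u \<in> normal_part"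
    have "u \<notin> point_conjugates x"
    proof
      assume "u \<in> point_conjugates x"
      then obtain g where g: "u \<in> carrier G" "u \<noteq> \<one>" "g \<in> carrier G" "parallel u (conjg G g x)"
        using point_conjugates_par[OF x(1,2)] by blast
      then have "nrm (conjg G g x) = carrier G"
        using u nrm_cong[of "conjg G g x" u] conjg_nontrivial[of g x] x by (auto simp: normal_part_def)
      then show False using nrm_conjg x g by blast
    qed
    then show "u \<in> carrier G - point_conjugates x" using u by (simp add: normal_part_def)
  qed
qed

text \<open>The complement of a set of |G|(1 - 1/|P|) elements, where P is \<open>point x\<close>:
  the order that a Frobenius kernel with complement P has.\<close>

lemma card_normal_part:
  assumes x: "x \<in> carrier G" "x \<noteq> \<one>" "nrm x \<noteq> carrier G"
  shows "card normal_part * card (point x) = card (carrier G)"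
proof -
  let ?U = "point_conjugates x" and ?p = "card (point x)"
  have U: "?U \<subseteq> carrier G" using point_conjugates_par[OF x(1,2)] by auto
  have "finite (point x)" using finite_carrier by (simp add: point_def)
  then have p: "?p \<ge> 1" using point_self[OF x(1)] by (auto simp: Suc_le_eq card_gt_0_iff)
  have "card normal_part = card (carrier G) - card ?U"
    using normal_part_complement[OF x] U finite_carrier finite_subset by (metis card_Diff_subset)
  then have "card normal_part * ?p = card (carrier G) * ?p - card ?U * ?p"
    by (simp add: diff_mult_distrib)
  also have "card ?U * ?p = card (carrier G) * (?p - 1)"
    using card_point_conjugates[OF x(1,2) nrm_dichotomy[OF x]] .
  also have "card (carrier G) * ?p - card (carrier G) * (?p - 1) = card (carrier G)"
    using p by (simp add: diff_mult_distrib2[symmetric])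
  finally show ?thesis .
qed

text \<open>The commutator lies in both normal points, and distinct points meet only in
  \<one>.\<close>

lemma normal_points_commute:
  assumes u: "u \<in> carrier G" "u \<noteq> \<one>" "nrm u = carrier G"
    and v: "v \<in> carrier G" "v \<noteq> \<one>" "nrm v = carrier G" and np: "\<not> parallel u v"
  shows "u \<otimes> v = v \<otimes> u"
proof -
  let ?c = "u \<otimes> v \<otimes> inv u \<otimes> inv v"
  interpret U: subgroup "point u" G by (rule point_subgroup[OF u(1,2)])
  interpret V: subgroup "point v" G by (rule point_subgroup[OF v(1,2)])
  have *: "conjg G g w \<in> point w" if "nrm w = carrier G" "g \<in> carrier G" "w \<in> carrier G" for g w
  proof -
    have "g \<in> nrm w" using that by simp
    then show ?thesis using conjg_in_point that(3) by blast
  qed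
  have "conjg G u v \<otimes> inv v \<in> point v"
    by (rule V.m_closed[OF *[OF v(3) u(1) v(1)] V.m_inv_closed[OF point_self[OF v(1)]]])
  moreover have "u \<otimes> inv (conjg G v u) \<in> point u"
    by (rule U.m_closed[OF point_self[OF u(1)] U.m_inv_closed[OF *[OF u(3) v(1) u(1)]]])
  moreover have "u \<otimes> inv (conjg G v u) = ?c" using u v by (simp add: m_assoc inv_mult_group)
  ultimately have c: "?c \<in> point u" "?c \<in> point v" by simp_all
  have "?c = \<one>"
  proof (rule ccontr)
    assume "?c \<noteq> \<one>"
    then have "parallel ?c u" "parallel ?c v"
      using c point_nontrivialD[of ?c u] point_nontrivialD[of ?c v] by blast+
    then have "parallel u v"
      using par_trans[OF U.mem_carrier[OF c(1)] \<open>?c \<noteq> \<one>\<close> par_sym[OF \<open>parallel ?c u\<close>]] by blast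
    then show False using np by simp
  qed
  then have "?c \<otimes> v \<otimes> u = v \<otimes> u" using u v by simp
  then show ?thesis using u v by (simp add: m_assoc)
qed

section \<open>Factorization of the group by its normal points and a nonnormal point\<close>

lemma nonnormal_centralizer:
  assumes q: "q \<in> carrier G" "q \<noteq> \<one>" "nrm q \<noteq> carrier G"
    and n: "n \<in> carrier G" "n \<otimes> q = q \<otimes> n"
  shows "n \<in> point q"
proof -
  have "conjg G n q = q" using q n by (simp add: m_assoc)
  then have "n \<in> nrm q" using n(1) by (simp add: nrm_def)
  then show ?thesis by (simp only: nrm_dichotomy[OF q])
qed


lemma point_cong:
  assumes y: "y \<in> point x" "y \<noteq> \<one>" and x: "x \<in> carrier G" "x \<noteq> \<one>"
  shows "point y = point x"
proof -
  have yc: "y \<in> carrier G" "parallel y x" using y by (auto simp: point_def)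
  show ?thesis
    unfolding point_def using par_trans[OF x _ par_sym[OF yc(2)]] par_trans[OF yc(1) y(2) _ yc(2)] by blast
qed

lemma nonnormal_point_not_normal_part:
  assumes n: "n \<in> normal_part" and x: "x \<in> carrier G" "x \<noteq> \<one>" "nrm x \<noteq> carrier G"
    and m: "m \<in> point x" "m \<noteq> \<one>"
  shows "m \<notin> normal_part"
proof
  assume "m \<in> normal_part"
  then have "nrm m = carrier G" using m by (simp add: normal_part_def)
  moreover have "m \<in> carrier G" "parallel m x" using m by (auto simp: point_def)
  ultimately show False using nrm_cong[OF x(1,2) _ m(2)] x(3) by simp
qed

lemma normal_part_inter_point:
  assumes x: "x \<in> carrier G" "x \<noteq> \<one>" "nrm x \<noteq> carrier G"
    and n: "n \<in> normal_part" "n \<in> point x"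
  shows "n = \<one>"
  using nonnormal_point_not_normal_part[OF n(1) x n(2)] n(1) by blast

text \<open>Suppose the quotient of \<open>m\<close> and \<open>n\<close> is nontrivial. If they are
  parallel, it lies in their common normal point. Otherwise they commute, so \<open>n\<close>
  centralizes the quotient and lies in \<open>point x\<close>. Both are impossible for nontrivial
  \<open>m\<close> and \<open>n\<close>.\<close>

lemma normal_part_div_point:
  assumes x: "x \<in> carrier G" "x \<noteq> \<one>" "nrm x \<noteq> carrier G"
    and n: "n \<in> normal_part" "m \<in> normal_part" and q: "inv m \<otimes> n \<in> point x"
  shows "m = n"
proof -
  have X: "subgroup (point x) G" by (rule point_subgroup[OF x(1,2)])
  have c: "n \<in> carrier G" "m \<in> carrier G" using n by (auto simp: normal_part_def)
  let ?q = "inv m \<otimes> n"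
  have qc: "?q \<in> carrier G" using c by simp
  have "?q = \<one>"
  proof (cases "n = \<one> \<or> m = \<one>")
    case True
    then show ?thesis
    proof
      assume "n = \<one>"
      then have "inv m \<in> point x" using q c by simp
      then have "inv (inv m) \<in> point x" by (rule subgroup.m_inv_closed[OF X])
      then have "m \<in> point x" using c by simp
      then have "m = \<one>" using normal_part_inter_point[OF x n(2)] by blast
      then show ?thesis using \<open>n = \<one>\<close> by simp
    next
      assume "m = \<one>"
      then have "n \<in> point x" using q c by simp
      then have "n = \<one>" using normal_part_inter_point[OF x n(1)] by blast
      then show ?thesis using \<open>m = \<one>\<close> by simp
    qed
  next
    case False
    then have nn: "nrm n = carrier G" "nrm m = carrier G" using n by (auto simp: normal_part_def)
    show ?thesis
    proof (rule ccontr)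
      assume q1: "?q \<noteq> \<one>"
      have qp: "nrm ?q = nrm x"
        using nrm_cong[OF x(1,2) qc q1] point_nontrivialD[of ?q x] q q1 by blast
      show False
      proof (cases "parallel m n")
        case True
        have n1: "n \<noteq> \<one>" using False by blast
        have "subgroup (point n) G" by (rule point_subgroup[OF c(1) n1])
        moreover have "m \<in> point n" "n \<in> point n" using True c by (simp_all add: point_def)
        ultimately have "?q \<in> point n" by (blast intro: subgroup.m_closed subgroup.m_inv_closed)
        then have "nrm ?q = nrm n"
          using nrm_cong[OF c(1) n1 qc q1] point_nontrivialD[of ?q n] q1 by blast
        then show False using qp nn x by simp
      next
        case F: False
        then have "m \<otimes> n = n \<otimes> m" using normal_points_commute[OF c(2) _ nn(2) c(1) _ nn(1)] False by blast
        then have com: "n \<otimes> ?q = ?q \<otimes> n" using c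
          by (metis inv_closed inv_mult_cancel(1) m_assoc m_closed)
        have "n \<in> point ?q" by (rule nonnormal_centralizer[OF qc q1 _ c(1) com]) (simp add: qp x)
        then have "n \<in> point x" using point_cong[OF q q1 x(1,2)] by simp
        then show False using normal_part_inter_point[OF x n(1)] False by blast
      qed
    qed
  qed
  then have "m \<otimes> ?q = m" using c by simp
  then show ?thesis using c by simp
qed

text \<open>The product map is injective by \<open>normal_part_div_point\<close>, and its domain has
  exactly as many elements as the group.\<close>

lemma normal_part_times_point:
  assumes x: "x \<in> carrier G" "x \<noteq> \<one>" "nrm x \<noteq> carrier G" and g: "g \<in> carrier G"
  obtains n p where "n \<in> normal_part" "p \<in> point x" "g = n \<otimes> p"
proof -
  interpret X: subgroup "point x" G by (rule point_subgroup[OF x(1,2)])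
  let ?f = "\<lambda>(n, p). n \<otimes> p" and ?S = "normal_part \<times> point x"
  have Nc: "normal_part \<subseteq> carrier G" by (auto simp: normal_part_def)
  have inj: "inj_on ?f ?S"
  proof (rule inj_onI, clarify)
    fix n p m q assume n: "n \<in> normal_part" "m \<in> normal_part" and p: "p \<in> point x" "q \<in> point x"
      and eq: "n \<otimes> p = m \<otimes> q"
    have c: "n \<in> carrier G" "m \<in> carrier G" "p \<in> carrier G" "q \<in> carrier G" using n p Nc by auto
    have "inv m \<otimes> n = inv m \<otimes> (n \<otimes> p) \<otimes> inv p" using c by (simp add: m_assoc)
    also have "\<dots> = q \<otimes> inv p" unfolding eq using c by (simp add: m_assoc)
    finally have "inv m \<otimes> n \<in> point x" using p by simp
    then have "m = n" by (rule normal_part_div_point[OF x n])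
    then show "n = m \<and> p = q" using eq c by simp
  qed
  have sub: "?f ` ?S \<subseteq> carrier G" using Nc X.subset by auto
  have "card (?f ` ?S) = card (carrier G)"
    using card_image[OF inj] card_normal_part[OF x] by (simp add: card_cartesian_product)
  then have "?f ` ?S = carrier G" using card_subset_eq[OF finite_carrier sub] by blast
  then show thesis using g that by force
qed

text \<open>A basis element outside \<open>H\<close> is parallel to a conjugate of \<open>x\<close>
  by some \<open>n \<otimes> p\<close>. The factor \<open>p\<close> stays within the point of
  \<open>x\<close>, so the element is parallel to the conjugate by \<open>n\<close>, which lies in
  \<open>H\<close>.\<close>

lemma normal_part_generates:
  assumes x: "x \<in> carrier G" "x \<noteq> \<one>" "nrm x \<noteq> carrier G"
    and H: "subgroup H G" "normal_part \<subseteq> H" "x \<in> H"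
  shows "H = carrier G"
proof (rule subgroup_absorbs_basis[OF H(1)])
  fix X y assume X: "basis X" "y \<in> X" and yH: "y \<notin> H"
  have yc: "y \<in> carrier G" "y \<noteq> \<one>" using basis_nontrivial[OF X] by blast+
  have "y \<notin> normal_part" using yH H by blast
  then have "nrm y \<noteq> carrier G" using yc by (simp add: normal_part_def)
  from nonnormal_conjugate[OF x yc this] obtain g where g: "g \<in> carrier G" "parallel y (conjg G g x)"
    unfolding point_conjugates_par[OF x(1,2)] by blast
  obtain n p where n: "n \<in> normal_part" and p: "p \<in> point x" and gnp: "g = n \<otimes> p"
    using normal_part_times_point[OF x g(1)] .
  have nc: "n \<in> carrier G" and pc: "p \<in> carrier G" using n p by (auto simp: normal_part_def point_def)
  let ?h = "conjg G n x"
  have hH: "?h \<in> H" using subgroup_conjg_closed[OF H(1) _ H(3)] n H(2) by blast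
  have hc: "?h \<in> carrier G \<and> ?h \<noteq> \<one>" using conjg_nontrivial[OF nc] x by blast
  have gc: "conjg G g x \<in> carrier G \<and> conjg G g x \<noteq> \<one>" using conjg_nontrivial[OF g(1)] x by blast
  have "parallel (conjg G p x) x" using point_subset_nrm[OF x(1,2)] p by (auto simp: nrm_def)
  then have "parallel (conjg G n (conjg G p x)) ?h" using par_conjg[OF nc, of "conjg G p x" x] pc x by simp
  then have "parallel (conjg G g x) ?h" unfolding gnp conjg_conjg[OF nc pc x(1)] .
  then have "parallel y ?h" using par_trans gc g(2) by blast
  then show "\<exists>h\<in>H. basis (insert h (X - {y}))"
    using par_subst[OF X par_sym] hc hH by blast
qed

lemma normal_part_nontrivial:
  assumes x: "x \<in> carrier G" "x \<noteq> \<one>" "nrm x \<noteq> carrier G"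
  obtains a where "a \<in> normal_part" "a \<noteq> \<one>"
proof -
  have "normal_part \<noteq> {\<one>}"
  proof
    assume "normal_part = {\<one>}"
    then have "card (point x) = card (carrier G)" using card_normal_part[OF x] by simp
    moreover have "point x \<subseteq> carrier G" by (auto simp: point_def)
    ultimately have "point x = carrier G" using card_subset_eq[OF finite_carrier] by blast
    then show False using point_subset_nrm[OF x(1,2)] x(3) by (auto simp: nrm_def)
  qed
  moreover have "\<one> \<in> normal_part" by (simp add: normal_part_def)
  ultimately show thesis using that by blast
qed

lemma normal_part_conjg:
  assumes "u \<in> normal_part" "g \<in> carrier G"
  shows "conjg G g u \<in> normal_part"
proof (cases "u = \<one>")
  case False
  then have u: "u \<in> carrier G" "nrm u = carrier G" using assms by (auto simp: normal_part_def)
  then have c: "conjg G g u \<in> carrier G" using assms by simp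
  have "nrm (conjg G g u) = carrier G"
    by (rule nrm_conjg[of _ "inv g"]) (use c u assms conjg_inv_cancel(1)[of g u] in simp_all)
  then show ?thesis using c by (simp add: normal_part_def)
qed (use assms in \<open>simp add: normal_part_def\<close>)

text \<open>Only parallel \<open>u\<close> and \<open>v\<close> need work. Take \<open>y\<close> in
  another normal point; then \<open>u \<otimes> y\<close> and \<open>y\<close> both commute with
  \<open>v\<close>, and so does \<open>u\<close>.\<close>

lemma normal_part_commute:
  assumes a: "a \<in> normal_part" "a \<noteq> \<one>" and b: "b \<in> normal_part" "b \<noteq> \<one>" and np: "\<not> parallel a b"
    and u: "u \<in> normal_part" and v: "v \<in> normal_part"
  shows "u \<otimes> v = v \<otimes> u"
proof (cases "u = \<one> \<or> v = \<one>")
  case True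
  then show ?thesis using u v by (auto simp: normal_part_def)
next
  case False
  have N: "w \<in> carrier G \<and> nrm w = carrier G" if "w \<in> normal_part" "w \<noteq> \<one>" for w
    using that by (simp add: normal_part_def)
  have uc: "u \<in> carrier G" "u \<noteq> \<one>" "nrm u = carrier G" using N[OF u] False by simp_all
  have vc: "v \<in> carrier G" "v \<noteq> \<one>" "nrm v = carrier G" using N[OF v] False by simp_all
  show ?thesis
  proof (cases "parallel u v")
    case False
    then show ?thesis using normal_points_commute[OF uc vc] by blast
  next
    case True
    have "\<exists>y. y \<in> normal_part \<and> y \<noteq> \<one> \<and> \<not> parallel u y"
      using a b np par_trans[OF uc(1,2), of a b] par_sym by blast
    then obtain y where y: "y \<in> normal_part" "y \<noteq> \<one>" and nuy: "\<not> parallel u y" by blast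
    have yc: "y \<in> carrier G" "y \<noteq> \<one>" "nrm y = carrier G" using N[OF y] y by simp_all
    let ?w = "u \<otimes> y"
    have uy: "?w = y \<otimes> u" by (rule normal_points_commute[OF uc yc nuy])
    have wc: "?w \<in> carrier G" using uc yc by simp
    interpret U: subgroup "point u" G by (rule point_subgroup[OF uc(1,2)])
    have uU: "u \<in> point u" by (rule point_self[OF uc(1)])
    have wU: "?w \<notin> point u"
    proof
      assume "?w \<in> point u"
      then have "inv u \<otimes> ?w \<in> point u" by (rule U.m_closed[OF U.m_inv_closed[OF uU]])
      then have "y \<in> point u" using uc yc by simp
      then show False using point_nontrivialD[of y u] yc(2) nuy par_sym by blast
    qed
    then have w1: "?w \<noteq> \<one>" using U.one_closed by metis
    \<comment> \<open>The product commutes with \<open>u\<close>. If its point were nonnormal, it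
      would have to contain \<open>u\<close>, which belongs to a normal point.\<close>
    have nw: "nrm ?w = carrier G"
    proof (rule ccontr)
      assume nn: "nrm ?w \<noteq> carrier G"
      have "u \<otimes> ?w = u \<otimes> (y \<otimes> u)" by (simp only: uy)
      also have "\<dots> = ?w \<otimes> u" using uc yc by (simp add: m_assoc)
      finally have "u \<otimes> ?w = ?w \<otimes> u" .
      then have "u \<in> point ?w" by (rule nonnormal_centralizer[OF wc w1 nn uc(1)])
      then have "parallel u ?w" using point_nontrivialD[of u ?w] uc(2) by blast
      then show False using nrm_cong[OF wc w1 uc(1,2)] uc(3) nn by simp
    qed
    have uwp: "\<not> parallel ?w u" using wU wc unfolding point_def by blast
    have wv: "\<not> parallel ?w v" using uwp par_trans[OF vc(1,2) _ par_sym[OF True]] by blast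
    have yv: "\<not> parallel y v" using nuy par_trans[OF vc(1,2) True] par_sym by blast
    have cw: "?w \<otimes> v = v \<otimes> ?w" by (rule normal_points_commute[OF wc w1 nw vc wv])
    have cy: "y \<otimes> v = v \<otimes> y" by (rule normal_points_commute[OF yc vc yv])
    have "(u \<otimes> v) \<otimes> y = u \<otimes> (y \<otimes> v)" using uc vc yc cy by (simp add: m_assoc)
    also have "\<dots> = v \<otimes> ?w" using uc vc yc cw by (simp add: m_assoc)
    also have "\<dots> = (v \<otimes> u) \<otimes> y" using uc vc yc by (simp add: m_assoc)
    finally show ?thesis using uc vc yc by simp
  qed
qed

section \<open>The cases of the loopless theorem\<close>

lemma solvable_if_all_normal:
  assumes n: "normal_part = carrier G"
  shows "solvable G"
proof -
  obtain X where X: "basis X" using basis_exists by blast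
  have "card X \<noteq> 0" "card X \<noteq> 1" using basis_card[OF X] rank_ge_two by auto
  then have "X \<noteq> {}" by auto
  then obtain a where a: "a \<in> X" by blast
  then have "X \<noteq> {a}" using \<open>card X \<noteq> 1\<close> by auto
  then obtain b where b: "b \<in> X" "b \<noteq> a" using a by blast
  have np: "\<not> parallel a b" using basis_not_par[OF X a b(1)] b by blast
  have nt: "a \<in> carrier G" "a \<noteq> \<one>" "b \<in> carrier G" "b \<noteq> \<one>" using basis_nontrivial[OF X] a b by blast+
  have "u \<otimes> v = v \<otimes> u" if "u \<in> carrier G" "v \<in> carrier G" for u v
    by (rule normal_part_commute[of a b]) (use nt np n that in simp_all)
  then have "solvable_seq G (carrier G)" using abelian_solvable_seq[OF subgroup_self] by blast
  then show ?thesis by (simp add: solvable_def)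
qed

text \<open>Here the Frattini argument applied to the normal point forces \<open>d = 2\<close> and a normal abelian
  subgroup with cyclic quotient.\<close>

lemma solvable_if_single_normal_point:
  assumes x: "x \<in> carrier G" "x \<noteq> \<one>" "nrm x \<noteq> carrier G"
    and a: "a \<in> normal_part" "a \<noteq> \<one>" and single: "\<And>b. b \<in> normal_part \<Longrightarrow> b \<noteq> \<one> \<Longrightarrow> parallel b a"
  shows "solvable G"
proof -
  have ac: "a \<in> carrier G" "nrm a = carrier G" using a by (auto simp: normal_part_def)
  have eq: "normal_part = point a"
  proof
    show "normal_part \<subseteq> point a" using single by (auto simp: normal_part_def point_def)
    show "point a \<subseteq> normal_part"
    proof
      fix b assume b: "b \<in> point a"
      then have "b \<in> carrier G" by (simp add: point_def)
      then show "b \<in> normal_part"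
        using nrm_cong[OF ac(1) a(2), of b] point_nontrivialD[of b a] b ac
        by (cases "b = \<one>") (simp_all add: normal_part_def)
    qed
  qed
  have sub: "subgroup normal_part G" using point_subgroup[OF ac(1) a(2)] eq by simp
  have normal: "normal_part \<lhd> G" using normal_invI[OF sub] normal_part_conjg by blast
  have "normal_part \<noteq> {\<one>}" using a by blast
  from frattini_abelian[OF finite_carrier normal this]
  obtain Z where Z: "subgroup Z G" "Z \<subseteq> normal_part" "Z \<noteq> {\<one>}"
    and Zab: "\<And>u v. u \<in> Z \<Longrightarrow> v \<in> Z \<Longrightarrow> u \<otimes> v = v \<otimes> u"
    and Zn: "\<And>g. g \<in> carrier G \<Longrightarrow> \<exists>b\<in>normal_part. \<forall>z\<in>Z. conjg G (b \<otimes> g) z \<in> Z" by blast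
  have Zc: "Z \<subseteq> carrier G" using subgroup.subset[OF Z(1)] .
  obtain b where b: "b \<in> normal_part" "\<And>z. z \<in> Z \<Longrightarrow> conjg G (b \<otimes> x) z \<in> Z" using Zn[OF x(1)] by blast
  \<comment> \<open>A replacement for \<open>x\<close> that normalizes \<open>Z\<close> and is still
    outside \<open>normal_part\<close>.\<close>
  let ?h = "b \<otimes> x"
  have bc: "b \<in> carrier G" using b by (simp add: normal_part_def)
  have hc: "?h \<in> carrier G" using bc x by simp
  have xN: "x \<notin> normal_part" using x by (simp add: normal_part_def)
  have hN: "?h \<notin> normal_part"
  proof
    assume "?h \<in> normal_part"
    then have "inv b \<otimes> ?h \<in> normal_part" by (rule subgroup.m_closed[OF sub subgroup.m_inv_closed[OF sub b(1)]])
    then show False using xN bc x by simp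
  qed
  then have h: "?h \<noteq> \<one>" "nrm ?h \<noteq> carrier G" using hc by (auto simp: normal_part_def)
  obtain c where c: "c \<in> Z" "c \<noteq> \<one>" using Z(3) subgroup.one_closed[OF Z(1)] by blast
  have cc: "c \<in> carrier G" using c Zc by blast
  have "c \<in> point a" using c(1) Z(2) eq by blast
  from point_cong[OF this c(2) ac(1) a(2)] have pc: "point c = normal_part" by (simp only: eq)
  have "\<not> parallel c ?h" using hN pc hc h par_sym by (auto simp: point_def)
  then obtain X where X: "basis X" "c \<in> X" "?h \<in> X" "c \<noteq> ?h" by (rule not_par_in_basis)
  \<comment> \<open>A third element \<open>m\<close> would leave \<open>c\<close> and
    \<open>?h\<close> in the hyperplane \<open>X - {m}\<close>. Its flat contains the nontrivial
    elements of the point of \<open>c\<close>, which is all of \<open>normal_part\<close>; together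
    with \<open>?h\<close> they generate the group, against
    \<open>generate_flat_proper\<close>.\<close>
  have Xeq: "X = {c, ?h}"
  proof (rule ccontr)
    assume "X \<noteq> {c, ?h}"
    then obtain m where m: "m \<in> X" "m \<noteq> c" "m \<noteq> ?h" using X by blast
    let ?I = "X - {m}"
    have I: "hyper ?I" using basis_hyper[OF X(1) m(1)] .
    have inI: "v \<in> flat ?I" if "v \<in> ?I" for v
      using that hyper_not_basis[OF I] basis_indep[OF X(1), of "{v}"] by (auto simp: flat_def insert_absorb)
    have cI: "c \<in> ?I" and hI: "?h \<in> ?I" using X m by auto
    let ?H = "generate G (flat ?I)"
    have "normal_part \<subseteq> ?H"
    proof
      fix v assume v: "v \<in> normal_part"
      show "v \<in> ?H"
      proof (cases "v = \<one> \<or> v \<in> ?I")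
        case True
        then show ?thesis using inI generate.one generate.incl by metis
      next
        case False
        then have "v \<noteq> c" "v \<noteq> \<one>" using cI by auto
        have vc: "v \<in> carrier G" "parallel v c" using v \<open>v \<noteq> \<one>\<close> unfolding pc[symmetric] point_def by auto
        have "\<not> basis (insert v ?I)" using basis_not_par[of "insert v ?I" v c] cI vc \<open>v \<noteq> c\<close> by blast
        then have "v \<in> flat ?I" using indep_nontrivial[OF vc(1) \<open>v \<noteq> \<one>\<close>] by (simp add: flat_def)
        then show ?thesis by (rule generate.incl)
      qed
    qed
    moreover have "?h \<in> ?H" using inI[OF hI] by (rule generate.incl)
    ultimately have "?H = carrier G"
      by (rule normal_part_generates[OF hc h generate_is_subgroup[OF flat_carrier]])
    then have "m \<in> ?H" using m X basis_carrier by blast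
    then have "\<not> basis (insert m ?I)" by (rule generate_flat_proper[OF I])
    then show False using X m by (simp add: insert_absorb)
  qed
  let ?N = "{g \<in> carrier G. \<forall>z\<in>Z. conjg G g z \<in> Z}"
  have Nsub: "subgroup ?N G"
  proof (rule finite_submonoid_is_subgroup)
    show "finite ?N" using finite_carrier by simp
    show "\<one> \<in> ?N" using Zc by auto
    fix u v assume u: "u \<in> ?N" and v: "v \<in> ?N"
    then have "conjg G (u \<otimes> v) z \<in> Z" if "z \<in> Z" for z
      using conjg_conjg[of u v z] that Zc by auto
    then show "u \<otimes> v \<in> ?N" using u v by simp
  qed auto
  \<comment> \<open>\<open>c\<close> normalizes \<open>Z\<close> as one of its elements and
    \<open>?h\<close> by construction. As they generate the group, \<open>Z\<close> is
    normal.\<close>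
  have "X \<subseteq> ?N"
    unfolding Xeq using cc hc b(2) subgroup_conjg_closed[OF Z(1) c(1)] by simp
  then have "generate G X \<subseteq> ?N" by (rule generate_subgroup_incl[OF _ Nsub])
  then have "carrier G \<subseteq> ?N" using X(1) by (simp add: basis_def)
  then have "Z \<lhd> G" by (intro normal_invI[OF Z(1)]) blast
  moreover have "generate G (insert ?h Z) = carrier G"
  proof
    have "X \<subseteq> insert ?h Z" using Xeq c by blast
    from mono_generate[OF this] show "carrier G \<subseteq> generate G (insert ?h Z)"
      using X(1) by (simp add: basis_def)
  qed (use generate_incl[of "insert ?h Z"] hc Zc in simp)
  ultimately show ?thesis using solvable_cyclic_extension[OF _ Zab hc] by blast
qed

lemma solvable_if_two_normal_points:
  assumes x: "x \<in> carrier G" "x \<noteq> \<one>" "nrm x \<noteq> carrier G"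
    and a: "a \<in> normal_part" "a \<noteq> \<one>" and b: "b \<in> normal_part" "b \<noteq> \<one>" and np: "\<not> parallel a b"
  shows "solvable G"
proof -
  have Nc: "normal_part \<subseteq> carrier G" by (auto simp: normal_part_def)
  let ?K = "generate G normal_part"
  have K: "?K \<lhd> G" using normal_generateI[OF Nc] normal_part_conjg by blast
  have Kc: "insert x ?K \<subseteq> carrier G" using generate_incl[OF Nc] x by blast
  have "generate G (insert x ?K) = carrier G"
    by (rule normal_part_generates[OF x generate_is_subgroup[OF Kc]])
      (auto intro!: generate.incl)
  then show ?thesis
    using solvable_cyclic_extension[OF K _ x(1)]
      generate_commute[OF Nc normal_part_commute[OF a b np]] by blast
qed

theorem loopless_solvable: "solvable G"
proof (cases "normal_part = carrier G")
  case True
  then show ?thesis by (rule solvable_if_all_normal)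
next
  case False
  then obtain x where x: "x \<in> carrier G" "x \<noteq> \<one>" "nrm x \<noteq> carrier G" by (auto simp: normal_part_def)
  obtain a where a: "a \<in> normal_part" "a \<noteq> \<one>" using normal_part_nontrivial[OF x] .
  show ?thesis
    using solvable_if_single_normal_point[OF x a] solvable_if_two_normal_points[OF x a] par_sym by blast
qed

end

lemma (in exchange_group) exchange_group_solvable: "solvable G"
proof (cases "d \<le> 1")
  case True
  then show ?thesis by (rule solvable_if_rank_le_one)
next
  case False
  interpret q: group_hom G "G Mod loops" "(#>) loops" by (rule group_hom_rcoset[OF loops_normal])
  interpret Q: exchange_group "G Mod loops" d by (rule quotient_exchange_group)
  interpret Q: loopless_exchange_group "G Mod loops" d
    by unfold_locales (use quotient_loops False in auto)
  have id: "group_hom G G id" by (simp add: group_hom_def group_hom_axioms_def group_axioms hom_def)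
  show ?thesis
    unfolding solvable_def
  proof (rule solvable_seq_condition[OF id q.group_hom_axioms _ _ subgroup_self loops_solvable])
    show "id ` loops \<subseteq> carrier G" using loops_carrier by simp
    show "kernel G (G Mod loops) ((#>) loops) \<subseteq> id ` loops"
      using rcoset_eq_self_iff[OF loops_subgroup] by (auto simp: kernel_def)
    show "solvable_seq (G Mod loops) ((#>) loops ` carrier G)"
      using Q.loopless_solvable by (simp add: solvable_def carrier_FactGroup)
  qed
qed

section \<open>Groups with the exchange property\<close>

text \<open>Sets of size \<open>d\<close> are enumerated by bijections from \<open>{1..d}\<close>.
  Injectivity ensures that overwriting position \<open>i\<close> really removes \<open>x\<close>
  from the set.\<close>

lemma MGSE_exchange_group:
  assumes G: "group G" and fin: "finite (carrier G)" and M: "MGSE G"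
  shows "exchange_group G (min_gen_number G)"
proof -
  interpret group G by (rule G)
  let ?d = "min_gen_number G"
  let ?P = "\<lambda>n. \<exists>S. S \<subseteq> carrier G \<and> finite S \<and> card S = n \<and> generate G S = carrier G"
  have "generate G (carrier G) = carrier G"
    using generate_incl[of "carrier G"] by (auto intro: generate.incl)
  \<comment> \<open>Some number satisfies the predicate, so \<open>LEAST\<close> attains its
    minimum.\<close>
  then have "?P (card (carrier G))" using fin by blast
  then have att: "?P ?d" unfolding min_gen_number_def by (rule LeastI)
  show ?thesis
  proof
    show "finite (carrier G)" by (rule fin)
    show "?d \<le> card S" if "S \<subseteq> carrier G" "generate G S = carrier G" for S
      unfolding min_gen_number_def
      by (rule Least_le) (use that fin finite_subset in blast)
    show "\<exists>S\<subseteq>carrier G. card S = ?d \<and> generate G S = carrier G" using att by blast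
    fix X Y x
    assume X: "X \<subseteq> carrier G" "card X = ?d" "generate G X = carrier G"
      and Y: "Y \<subseteq> carrier G" "card Y = ?d" "generate G Y = carrier G" and x: "x \<in> X"
    have "finite X" "finite Y" using X Y fin finite_subset by blast+
    then obtain f h where f: "bij_betw f {1..?d} X" and h: "bij_betw h {1..?d} Y"
      using ex_bij_betw_nat_finite_1 X(2) Y(2) by metis
    have im: "f ` {1..?d} = X" "h ` {1..?d} = Y" using f h by (auto simp: bij_betw_def)
    then obtain i where i: "i \<in> {1..?d}" "x = f i" using x by blast
    have "f \<in> {1..?d} \<rightarrow> carrier G" "h \<in> {1..?d} \<rightarrow> carrier G" using im X Y by auto
    then have "\<exists>j\<in>{1..?d}. generate G ((f(i := h j)) ` {1..?d}) = carrier G"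
      using M[unfolded MGSE_def Let_def] im X(3) Y(3) i(1) by metis
    then obtain j where j: "j \<in> {1..?d}" "generate G ((f(i := h j)) ` {1..?d}) = carrier G" by blast
    have "(f(i := h j)) ` {1..?d} = insert (h j) (f ` ({1..?d} - {i}))" using i by auto
    also have "f ` ({1..?d} - {i}) = X - {x}"
      using inj_on_image_set_diff[of f "{1..?d}" "{1..?d}" "{i}"] f i im
      by (simp add: bij_betw_def)
    finally show "\<exists>y\<in>Y. generate G (insert y (X - {x})) = carrier G"
      using j im by (metis imageI)
  qed
qed

theorem theorem1p2:
  fixes G :: "('a, 'b) monoid_scheme"
  assumes "group G"
    and "finite (carrier G)"
    and "MGSE G"
  shows "solvable G"
  using exchange_group.exchange_group_solvable[OF MGSE_exchange_group[OF assms]] .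

end
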